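(* Let $S14o$ be the bialgebra defined in the context. Then $S14o$ is identified with the matrix bialgebra of the two-parameter deformation $GL_{p,q}(2)$ at $p=q=-1$. Explicitly, with $$\hat a=\tilde a+\tilde b,\quad \hat b=\tilde d-\tilde c,\quad \hat c=\tilde c+\tilde d,\quad \hat d=\tilde a-\tilde b,$$ the defining relations of $S14o$ are equivalent to $$\hat b\hat a=-\hat a\hat b,\quad \hat c\hat a=-\hat a\hat c,\quad \hat d\hat a=\hat a\hat d,\quad \hat c\hat b=\hat b\hat c,\quad \hat b\hat d=-\hat d\hat b,\quad \hat c\hat d=-\hat d\hat c,$$ and the coproduct and counit are the classical ones: $$\delta\begin{pmatrix}\hat a&\hat b\\\hat c&\hat d\end{pmatrix}=\begin{pmatrix}\hat a\otimes\hat a+\hat b\otimes\hat c&\hat a\otimes\hat b+\hat b\otimes\hat d\\\hat c\otimes\hat a+\hat d\otimes\hat c&\hat c\otimes\hat b+\hat d\otimes\hat d\end{pmatrix},\qquad \varepsilon\begin{pmatrix}\hat a&\hat b\\\hat c&\hat d\end{pmatrix}=\begin{pmatrix}1&0\\0&1\end{pmatrix}.$$ Let $\omega=\hat a\hat d+\hat b\hat c$. If $S14o$ is extended by an element $\omega^{-1}$ with $\omega\omega^{-1}=\omega^{-1}\omega=1$, $\delta(\omega^{\pm1})=\omega^{\pm1}\otimes\omega^{\pm1}$, $\varepsilon(\omega^{\pm1})=1$, then the extension has an antipode, with $$\gamma\begin{pmatrix}\hat a&\hat b\\\hat c&\hat d\end{pmatrix}=\omega^{-1}\begin{pmatrix}\hat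 d&\hat b\\\hat c&\hat a\end{pmatrix},\qquad \gamma(\omega^{\pm1})=\omega^{\mp1}.$$
   Context: $S14o$ is the unital associative $\mathbb{C}$-algebra generated by $\tilde a,\tilde b,\tilde c,\tilde d$ with relations $\tilde b\tilde a=\tilde a\tilde b$, $\tilde c\tilde a=-\tilde a\tilde c$, $\tilde d\tilde a=-\tilde a\tilde d$, $\tilde c\tilde b=-\tilde b\tilde c$, $\tilde d\tilde b=-\tilde b\tilde d$, $\tilde d\tilde c=\tilde c\tilde d$ (these are the RTT relations for the $R$-matrix $R_{S1,4}$ at $q=1$). It is a bialgebra with $\delta\tilde a=\tilde a\otimes\tilde a+\tilde b\otimes\tilde b-\tilde c\otimes\tilde c+\tilde d\otimes\tilde d$, $\delta\tilde b=\tilde a\otimes\tilde b+\tilde b\otimes\tilde a-\tilde c\otimes\tilde d+\tilde d\otimes\tilde c$, $\delta\tilde c=\tilde a\otimes\tilde c+\tilde c\otimes\tilde a-\tilde b\otimes\tilde d+\tilde d\otimes\tilde b$, $\delta\tilde d=\tilde a\otimes\tilde d+\tilde d\otimes\tilde a-\tilde b\otimes\tilde c+\tilde c\otimes\tilde b$, $\varepsilon(\tilde a)=1$, $\varepsilon(\tilde b)=\varepsilon(\tilde c)=\varepsilon(\tilde d)=0$. The matrix bialgebra of $GL_{p,q}(2)$ at $p=q=-1$ is the one generated by $\hat a,\hat b,\hat c,\hat d$ with exactly the hatted commutation relations and the classical coproduct and counit displayed in the claim; its quantum determinant is $\omega$. *)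

theory Defs
  imports Complex_Main "HOL-Library.Poly_Mapping"
begin

section \<open>Unital associative complex algebras\<close>

class scaleC =
  fixes scaleC :: "complex \<Rightarrow> 'a \<Rightarrow> 'a" (infixr \<open>*\<^sub>C\<close> 75)

class complex_vector = scaleC + ab_group_add +
  assumes scaleC_add_right: "c *\<^sub>C (x + y) = c *\<^sub>C x + c *\<^sub>C y"
    and scaleC_add_left: "(c + d) *\<^sub>C x = c *\<^sub>C x + d *\<^sub>C x"
    and scaleC_scaleC: "c *\<^sub>C (d *\<^sub>C x) = (c * d) *\<^sub>C x"
    and scaleC_one: "1 *\<^sub>C x = x"

global_interpretation complex_vector: vector_space "scaleC :: complex \<Rightarrow> 'a \<Rightarrow> 'a::complex_vector"
  by unfold_locales (simp_all add: scaleC_add_right scaleC_add_left scaleC_scaleC scaleC_one)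

abbreviation clinear :: "('a::complex_vector \<Rightarrow> 'b::complex_vector) \<Rightarrow> bool"
  where "clinear \<equiv> Vector_Spaces.linear (*\<^sub>C) (*\<^sub>C)"

lemma clinearI:
  assumes "\<And>x y. f (x + y) = f x + f y" "\<And>c x. f (c *\<^sub>C x) = c *\<^sub>C f x"
  shows "clinear f"
  by unfold_locales (use assms in auto)

text \<open>The class \<^class>\<open>ring_1\<close> is not used because it excludes the zero algebra, which cannot be
  ruled out in general for algebras given by generators and relations.\<close>

class complex_algebra = complex_vector + ring + monoid_mult +
  assumes mult_scaleC_left: "(c *\<^sub>C x) * y = c *\<^sub>C (x * y)"
    and mult_scaleC_right: "x * (c *\<^sub>C y) = c *\<^sub>C (x * y)"

instantiation complex :: complex_algebra
begin
definition scaleC_complex :: "complex \<Rightarrow> complex \<Rightarrow> complex" where "scaleC_complex = (*)"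
instance by standard (simp_all add: scaleC_complex_def algebra_simps)
end

definition algebra_hom :: "('a::complex_algebra \<Rightarrow> 'b::complex_algebra) \<Rightarrow> bool" where
  "algebra_hom f \<longleftrightarrow> clinear f \<and> f 1 = 1 \<and> (\<forall>x y. f (x * y) = f x * f y)"

inductive_set two_sided_ideal :: "'a::complex_algebra set \<Rightarrow> 'a set" for R where
  base: "r \<in> R \<Longrightarrow> r \<in> two_sided_ideal R"
| zero: "0 \<in> two_sided_ideal R"
| add: "x \<in> two_sided_ideal R \<Longrightarrow> y \<in> two_sided_ideal R \<Longrightarrow> x + y \<in> two_sided_ideal R"
| mult_left: "x \<in> two_sided_ideal R \<Longrightarrow> a * x \<in> two_sided_ideal R"
| mult_right: "x \<in> two_sided_ideal R \<Longrightarrow> x * a \<in> two_sided_ideal R"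

lemma two_sided_ideal_scaleC:
  assumes "x \<in> two_sided_ideal R" shows "c *\<^sub>C x \<in> two_sided_ideal R"
proof -
  have "c *\<^sub>C x = (c *\<^sub>C 1) * x" by (simp add: mult_scaleC_left)
  then show ?thesis using assms by (simp add: two_sided_ideal.mult_left)
qed

lemma two_sided_ideal_uminus:
  assumes "x \<in> two_sided_ideal R" shows "- x \<in> two_sided_ideal R"
  using two_sided_ideal_scaleC[OF assms, of "-1"] by simp

lemma two_sided_ideal_diff:
  assumes "x \<in> two_sided_ideal R" "y \<in> two_sided_ideal R" shows "x - y \<in> two_sided_ideal R"
  using two_sided_ideal.add[OF assms(1) two_sided_ideal_uminus[OF assms(2)]] by simp


section \<open>Free algebras and algebras given by generators and relations\<close>

instantiation poly_mapping :: (type, complex_vector) complex_vector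
begin
lift_definition scaleC_poly_mapping :: "complex \<Rightarrow> ('a \<Rightarrow>\<^sub>0 'b) \<Rightarrow> 'a \<Rightarrow>\<^sub>0 'b"
  is "\<lambda>c f k. c *\<^sub>C f k"
  by (erule rev_finite_subset) auto
instance
  by standard (transfer; simp add: fun_eq_iff scaleC_add_right scaleC_add_left scaleC_scaleC scaleC_one)+
end

lemma lookup_scaleC [simp]: "Poly_Mapping.lookup (c *\<^sub>C p) k = c *\<^sub>C Poly_Mapping.lookup p k"
  by transfer simp

text \<open>Linear extension of a map defined on a basis.\<close>

definition extend_linear :: "('k \<Rightarrow> 'v::complex_vector) \<Rightarrow> ('k \<Rightarrow>\<^sub>0 complex) \<Rightarrow> 'v" where
  "extend_linear f p = (\<Sum>k\<in>Poly_Mapping.keys p. Poly_Mapping.lookup p k *\<^sub>C f k)"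

lemma extend_linear_superset:
  assumes "finite A" "Poly_Mapping.keys p \<subseteq> A"
  shows "extend_linear f p = (\<Sum>k\<in>A. Poly_Mapping.lookup p k *\<^sub>C f k)"
  unfolding extend_linear_def
  by (rule sum.mono_neutral_left) (use assms in \<open>auto simp: in_keys_iff\<close>)

lemma clinear_extend_linear: "clinear (extend_linear f)"
proof (rule clinearI)
  fix p q :: "'a \<Rightarrow>\<^sub>0 complex"
  let ?A = "Poly_Mapping.keys p \<union> Poly_Mapping.keys q"
  have "Poly_Mapping.keys (p + q) \<subseteq> ?A" by (rule Poly_Mapping.keys_add)
  then have "extend_linear f (p + q) = (\<Sum>k\<in>?A. Poly_Mapping.lookup (p + q) k *\<^sub>C f k)"
    by (intro extend_linear_superset) auto
  also have "\<dots> = (\<Sum>k\<in>?A. Poly_Mapping.lookup p k *\<^sub>C f k) + (\<Sum>k\<in>?A. Poly_Mapping.lookup q k *\<^sub>C f k)"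
    by (simp add: lookup_add scaleC_add_left sum.distrib)
  also have "\<dots> = extend_linear f p + extend_linear f q"
    by (simp add: extend_linear_superset[of ?A])
  finally show "extend_linear f (p + q) = extend_linear f p + extend_linear f q" .
next
  fix c :: complex and p :: "'a \<Rightarrow>\<^sub>0 complex"
  have "Poly_Mapping.keys (c *\<^sub>C p) \<subseteq> Poly_Mapping.keys p" by (auto simp: in_keys_iff scaleC_complex_def)
  then have "extend_linear f (c *\<^sub>C p) = (\<Sum>k\<in>Poly_Mapping.keys p. Poly_Mapping.lookup (c *\<^sub>C p) k *\<^sub>C f k)"
    by (intro extend_linear_superset) auto
  also have "\<dots> = c *\<^sub>C extend_linear f p"
    by (simp add: extend_linear_def complex_vector.scale_sum_right scaleC_scaleC scaleC_complex_def)
  finally show "extend_linear f (c *\<^sub>C p) = c *\<^sub>C extend_linear f p" .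
qed

lemma extend_linear_single: "extend_linear f (Poly_Mapping.single k c) = c *\<^sub>C f k"
  by (simp add: extend_linear_def)

lemma extend_linear_add: "extend_linear f (p + q) = extend_linear f p + extend_linear f q"
  using clinear_extend_linear Vector_Spaces.linear_iff by blast

lemma scaleC_single: "c *\<^sub>C Poly_Mapping.single k d = Poly_Mapping.single k (c *\<^sub>C d)"
  by (rule poly_mapping_eqI) (simp add: lookup_single when_def)

lemma poly_mapping_single_induct [case_names zero single add]:
  fixes p :: "'k \<Rightarrow>\<^sub>0 'b::comm_monoid_add"
  assumes "P 0" "\<And>k c. P (Poly_Mapping.single k c)" "\<And>p q. P p \<Longrightarrow> P q \<Longrightarrow> P (p + q)"
  shows "P p"
proof -
  let ?s = "\<lambda>k. Poly_Mapping.single k (Poly_Mapping.lookup p k)"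
  have P: "P (sum ?s A)" if "finite A" for A
    using that
  proof (induction A rule: finite_induct)
    case empty show ?case using assms(1) by simp
  next
    case (insert k A)
    show ?case unfolding sum.insert[OF insert.hyps] by (intro assms(2,3) insert.IH)
  qed
  have "sum ?s (Poly_Mapping.keys p) = p"
  proof (rule poly_mapping_eqI)
    fix k
    have "Poly_Mapping.lookup (sum ?s (Poly_Mapping.keys p)) k
        = (\<Sum>l\<in>Poly_Mapping.keys p. if l = k then Poly_Mapping.lookup p l else 0)"
      by (simp only: lookup_sum lookup_single when_def)
    also have "\<dots> = Poly_Mapping.lookup p k"
      by (simp only: sum.delta finite_keys in_keys_iff split: if_split) simp
    finally show "Poly_Mapping.lookup (sum ?s (Poly_Mapping.keys p)) k = Poly_Mapping.lookup p k" .
  qed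
  with P[OF finite_keys] show ?thesis by metis
qed

text \<open>Words in the generators form the free monoid, written additively as required by the
  convolution product on \<^type>\<open>poly_mapping\<close>.  Hence \<open>'g list \<Rightarrow>\<^sub>0 complex\<close> is the free unital
  associative algebra on \<open>'g\<close>.\<close>

instantiation list :: (type) monoid_add
begin
definition zero_list :: "'a list" where "zero_list = []"
definition plus_list :: "'a list \<Rightarrow> 'a list \<Rightarrow> 'a list" where "plus_list = (@)"
instance by standard (simp_all add: zero_list_def plus_list_def)
end

type_synonym 'g free_algebra = "'g list \<Rightarrow>\<^sub>0 complex"

lemma mult_scaleC_poly_mapping:
  fixes p q :: "'a::monoid_add \<Rightarrow>\<^sub>0 'b::{complex_algebra,ring_1}"
  shows "(c *\<^sub>C p) * q = c *\<^sub>C (p * q)" "p * (c *\<^sub>C q) = c *\<^sub>C (p * q)"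
proof -
  let ?e = "Poly_Mapping.single (0::'a) (c *\<^sub>C (1::'b))"
  have l: "?e * r = c *\<^sub>C r" for r :: "'a \<Rightarrow>\<^sub>0 'b"
    by (induct r rule: poly_mapping_single_induct)
      (simp_all add: mult_single scaleC_single mult_scaleC_left distrib_left scaleC_add_right)
  have r: "r * ?e = c *\<^sub>C r" for r :: "'a \<Rightarrow>\<^sub>0 'b"
    by (induct r rule: poly_mapping_single_induct)
      (simp_all add: mult_single scaleC_single mult_scaleC_right distrib_right scaleC_add_right)
  show "(c *\<^sub>C p) * q = c *\<^sub>C (p * q)" by (metis l mult.assoc)
  show "p * (c *\<^sub>C q) = c *\<^sub>C (p * q)" by (metis r mult.assoc)
qed

instance poly_mapping :: (monoid_add, "{complex_algebra,ring_1}") complex_algebra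
  by standard (simp_all add: mult_scaleC_poly_mapping)

definition free_gen :: "'g \<Rightarrow> 'g free_algebra" where
  "free_gen g = Poly_Mapping.single [g] 1"

text \<open>The homomorphism from the free algebra determined by its values on the generators.\<close>

definition free_lift :: "('g \<Rightarrow> 'a::complex_algebra) \<Rightarrow> 'g free_algebra \<Rightarrow> 'a" where
  "free_lift v = extend_linear (\<lambda>w. prod_list (map v w))"

text \<open>A type \<open>'g\<close> of generators in this class carries a set of relators, i.e. the elements of the
  free algebra that are set to zero; \<open>'g presented\<close> is the resulting algebra.\<close>

class presentation =
  fixes relators :: "('a list \<Rightarrow>\<^sub>0 complex) set"

definition presented_rel :: "'g::presentation free_algebra \<Rightarrow> 'g free_algebra \<Rightarrow> bool" where
  "presented_rel p q \<longleftrightarrow> p - q \<in> two_sided_ideal relators"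

lemma equivp_presented_rel: "equivp (presented_rel :: 'g::presentation free_algebra \<Rightarrow> _)"
proof (rule equivpI)
  show "reflp (presented_rel :: 'g free_algebra \<Rightarrow> _)"
    by (simp add: reflp_def presented_rel_def two_sided_ideal.zero)
  show "symp (presented_rel :: 'g free_algebra \<Rightarrow> _)"
    by (metis (no_types, lifting) minus_diff_eq presented_rel_def sympI two_sided_ideal_uminus)
  show "transp (presented_rel :: 'g free_algebra \<Rightarrow> _)"
  proof (rule transpI)
    fix x y z :: "'g free_algebra"
    assume "presented_rel x y" "presented_rel y z"
    then have "(x - y) + (y - z) \<in> two_sided_ideal relators"
      unfolding presented_rel_def by (rule two_sided_ideal.add)
    then show "presented_rel x z" by (simp add: presented_rel_def)
  qed
qed

quotient_type (overloaded) 'g presented =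
    "'g::presentation list \<Rightarrow>\<^sub>0 complex" / presented_rel
  by (rule equivp_presented_rel)

instantiation presented :: (presentation) complex_algebra
begin

lift_definition zero_presented :: "'a presented" is 0 .
lift_definition one_presented :: "'a presented" is 1 .
lift_definition plus_presented :: "'a presented \<Rightarrow> 'a presented \<Rightarrow> 'a presented" is "(+)"
proof -
  fix p p' q q' :: "'a free_algebra"
  assume "presented_rel p p'" "presented_rel q q'"
  then have "(p - p') + (q - q') \<in> two_sided_ideal relators"
    unfolding presented_rel_def by (rule two_sided_ideal.add)
  then show "presented_rel (p + q) (p' + q')" by (simp add: presented_rel_def algebra_simps)
qed
lift_definition uminus_presented :: "'a presented \<Rightarrow> 'a presented" is uminus
proof -
  fix p p' :: "'a free_algebra"
  assume "presented_rel p p'"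
  then have "- (p - p') \<in> two_sided_ideal relators"
    unfolding presented_rel_def by (rule two_sided_ideal_uminus)
  then show "presented_rel (- p) (- p')" by (simp add: presented_rel_def)
qed
lift_definition minus_presented :: "'a presented \<Rightarrow> 'a presented \<Rightarrow> 'a presented" is "(-)"
proof -
  fix p p' q q' :: "'a free_algebra"
  assume "presented_rel p p'" "presented_rel q q'"
  then have "(p - p') - (q - q') \<in> two_sided_ideal relators"
    unfolding presented_rel_def by (rule two_sided_ideal_diff)
  then show "presented_rel (p - q) (p' - q')" by (simp add: presented_rel_def algebra_simps)
qed
lift_definition times_presented :: "'a presented \<Rightarrow> 'a presented \<Rightarrow> 'a presented" is "(*)"
proof -
  fix p p' q q' :: "'a free_algebra"
  assume "presented_rel p p'" "presented_rel q q'"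
  then have "(p - p') * q + p' * (q - q') \<in> two_sided_ideal relators"
    unfolding presented_rel_def
    by (intro two_sided_ideal.add two_sided_ideal.mult_left two_sided_ideal.mult_right)
  then show "presented_rel (p * q) (p' * q')" by (simp add: presented_rel_def algebra_simps)
qed
lift_definition scaleC_presented :: "complex \<Rightarrow> 'a presented \<Rightarrow> 'a presented" is "(*\<^sub>C)"
proof -
  fix c :: complex and p p' :: "'a free_algebra"
  assume "presented_rel p p'"
  then have "c *\<^sub>C (p - p') \<in> two_sided_ideal relators"
    unfolding presented_rel_def by (rule two_sided_ideal_scaleC)
  then show "presented_rel (c *\<^sub>C p) (c *\<^sub>C p')"
    by (simp add: presented_rel_def complex_vector.scale_right_diff_distrib)
qed

instance
proof
  have eq: "presented_rel p q" if "p = q" for p q :: "'a free_algebra"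
    using that by (simp add: presented_rel_def two_sided_ideal.zero)
  fix a b c :: "'a presented" and x y :: complex
  show "a + b + c = a + (b + c)" by transfer (rule eq, simp add: algebra_simps)
  show "a + b = b + a" by transfer (rule eq, simp add: algebra_simps)
  show "0 + a = a" by transfer (rule eq, simp)
  show "- a + a = 0" by transfer (rule eq, simp)
  show "a - b = a + - b" by transfer (rule eq, simp)
  show "a * b * c = a * (b * c)" by transfer (rule eq, simp add: algebra_simps)
  show "(a + b) * c = a * c + b * c" by transfer (rule eq, simp add: algebra_simps)
  show "a * (b + c) = a * b + a * c" by transfer (rule eq, simp add: algebra_simps)
  show "1 * a = a" by transfer (rule eq, simp)
  show "a * 1 = a" by transfer (rule eq, simp)
  show "x *\<^sub>C (a + b) = x *\<^sub>C a + x *\<^sub>C b" by transfer (rule eq, simp add: scaleC_add_right)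
  show "(x + y) *\<^sub>C a = x *\<^sub>C a + y *\<^sub>C a" by transfer (rule eq, simp add: scaleC_add_left)
  show "x *\<^sub>C (y *\<^sub>C a) = (x * y) *\<^sub>C a" by transfer (rule eq, simp add: scaleC_scaleC)
  show "1 *\<^sub>C a = a" by transfer (rule eq, simp add: scaleC_one)
  show "(x *\<^sub>C a) * b = x *\<^sub>C (a * b)" by transfer (rule eq, simp add: mult_scaleC_left)
  show "a * (x *\<^sub>C b) = x *\<^sub>C (a * b)" by transfer (rule eq, simp add: mult_scaleC_right)
qed

end

definition gen :: "'g::presentation \<Rightarrow> 'g presented" where
  "gen g = abs_presented (free_gen g)"

text \<open>The homomorphism from \<open>'g presented\<close> determined by the values \<open>v\<close> on the generators.  It is
  only meaningful if \<open>v\<close> respects the relations; otherwise the value depends on the chosen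
  representatives.\<close>

definition presented_lift :: "('g::presentation \<Rightarrow> 'a::complex_algebra) \<Rightarrow> 'g presented \<Rightarrow> 'a" where
  "presented_lift v x = free_lift v (rep_presented x)"


section \<open>Tensor products\<close>

definition tensor_null :: "('a::complex_vector \<times> 'b::complex_vector \<Rightarrow>\<^sub>0 complex) set" where
  "tensor_null = complex_vector.span (
     {Poly_Mapping.single (x + x', y) 1 - Poly_Mapping.single (x, y) 1
        - Poly_Mapping.single (x', y) 1 | x x' y. True} \<union>
     {Poly_Mapping.single (x, y + y') 1 - Poly_Mapping.single (x, y) 1
        - Poly_Mapping.single (x, y') 1 | x y y'. True} \<union>
     {Poly_Mapping.single (c *\<^sub>C x, y) 1 - c *\<^sub>C Poly_Mapping.single (x, y) 1 | c x y. True} \<union>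
     {Poly_Mapping.single (x, c *\<^sub>C y) 1 - c *\<^sub>C Poly_Mapping.single (x, y) 1 | c x y. True})"

definition tensor_rel :: "('a::complex_vector \<times> 'b::complex_vector \<Rightarrow>\<^sub>0 complex) \<Rightarrow>
    ('a \<times> 'b \<Rightarrow>\<^sub>0 complex) \<Rightarrow> bool" where
  "tensor_rel p q \<longleftrightarrow> p - q \<in> tensor_null"

lemma equivp_tensor_rel:
  "equivp (tensor_rel :: ('a::complex_vector \<times> 'b::complex_vector \<Rightarrow>\<^sub>0 complex) \<Rightarrow> _)"
proof (rule equivpI)
  show "reflp (tensor_rel :: ('a \<times> 'b \<Rightarrow>\<^sub>0 complex) \<Rightarrow> _)"
    by (simp add: reflp_def tensor_rel_def tensor_null_def complex_vector.span_zero)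
  show "symp (tensor_rel :: ('a \<times> 'b \<Rightarrow>\<^sub>0 complex) \<Rightarrow> _)"
    by (metis (no_types, lifting) minus_diff_eq tensor_rel_def tensor_null_def sympI
        complex_vector.span_neg)
  show "transp (tensor_rel :: ('a \<times> 'b \<Rightarrow>\<^sub>0 complex) \<Rightarrow> _)"
  proof (rule transpI)
    fix x y z :: "'a \<times> 'b \<Rightarrow>\<^sub>0 complex"
    assume "tensor_rel x y" "tensor_rel y z"
    then have "(x - y) + (y - z) \<in> tensor_null"
      unfolding tensor_rel_def tensor_null_def by (rule complex_vector.span_add)
    then show "tensor_rel x z" by (simp add: tensor_rel_def)
  qed
qed

quotient_type (overloaded) ('a, 'b) tensor =
    "'a::complex_vector \<times> 'b::complex_vector \<Rightarrow>\<^sub>0 complex" / tensor_rel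
  by (rule equivp_tensor_rel)

instantiation tensor :: (complex_vector, complex_vector) complex_vector
begin

lift_definition zero_tensor :: "('a, 'b) tensor" is 0 .
lift_definition plus_tensor :: "('a, 'b) tensor \<Rightarrow> ('a, 'b) tensor \<Rightarrow> ('a, 'b) tensor" is "(+)"
proof -
  fix p p' q q' :: "'a \<times> 'b \<Rightarrow>\<^sub>0 complex"
  assume "tensor_rel p p'" "tensor_rel q q'"
  then have "(p - p') + (q - q') \<in> tensor_null"
    unfolding tensor_rel_def tensor_null_def by (rule complex_vector.span_add)
  then show "tensor_rel (p + q) (p' + q')" by (simp add: tensor_rel_def algebra_simps)
qed
lift_definition uminus_tensor :: "('a, 'b) tensor \<Rightarrow> ('a, 'b) tensor" is uminus
proof -
  fix p p' :: "'a \<times> 'b \<Rightarrow>\<^sub>0 complex"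
  assume "tensor_rel p p'"
  then have "- (p - p') \<in> tensor_null"
    unfolding tensor_rel_def tensor_null_def by (rule complex_vector.span_neg)
  then show "tensor_rel (- p) (- p')" by (simp add: tensor_rel_def)
qed
lift_definition minus_tensor :: "('a, 'b) tensor \<Rightarrow> ('a, 'b) tensor \<Rightarrow> ('a, 'b) tensor" is "(-)"
proof -
  fix p p' q q' :: "'a \<times> 'b \<Rightarrow>\<^sub>0 complex"
  assume "tensor_rel p p'" "tensor_rel q q'"
  then have "(p - p') - (q - q') \<in> tensor_null"
    unfolding tensor_rel_def tensor_null_def by (rule complex_vector.span_diff)
  then show "tensor_rel (p - q) (p' - q')" by (simp add: tensor_rel_def algebra_simps)
qed
lift_definition scaleC_tensor :: "complex \<Rightarrow> ('a, 'b) tensor \<Rightarrow> ('a, 'b) tensor" is "(*\<^sub>C)"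
proof -
  fix c :: complex and p p' :: "'a \<times> 'b \<Rightarrow>\<^sub>0 complex"
  assume "tensor_rel p p'"
  then have "c *\<^sub>C (p - p') \<in> tensor_null"
    unfolding tensor_rel_def tensor_null_def by (rule complex_vector.span_scale)
  then show "tensor_rel (c *\<^sub>C p) (c *\<^sub>C p')"
    by (simp add: tensor_rel_def complex_vector.scale_right_diff_distrib)
qed

instance
proof
  have eq: "tensor_rel p q" if "p = q" for p q :: "'a \<times> 'b \<Rightarrow>\<^sub>0 complex"
    using that by (simp add: tensor_rel_def tensor_null_def complex_vector.span_zero)
  fix a b c :: "('a, 'b) tensor" and x y :: complex
  show "a + b + c = a + (b + c)" by transfer (rule eq, simp add: algebra_simps)
  show "a + b = b + a" by transfer (rule eq, simp add: algebra_simps)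
  show "0 + a = a" by transfer (rule eq, simp)
  show "- a + a = 0" by transfer (rule eq, simp)
  show "a - b = a + - b" by transfer (rule eq, simp)
  show "x *\<^sub>C (a + b) = x *\<^sub>C a + x *\<^sub>C b" by transfer (rule eq, simp add: scaleC_add_right)
  show "(x + y) *\<^sub>C a = x *\<^sub>C a + y *\<^sub>C a" by transfer (rule eq, simp add: scaleC_add_left)
  show "x *\<^sub>C (y *\<^sub>C a) = (x * y) *\<^sub>C a" by transfer (rule eq, simp add: scaleC_scaleC)
  show "1 *\<^sub>C a = a" by transfer (rule eq, simp add: scaleC_one)
qed

end

definition tensor :: "'a::complex_vector \<Rightarrow> 'b::complex_vector \<Rightarrow> ('a, 'b) tensor"
    (infixr \<open>\<otimes>\<close> 72) where
  "x \<otimes> y = abs_tensor (Poly_Mapping.single (x, y) 1)"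

definition cbilinear ::
    "('a::complex_vector \<Rightarrow> 'b::complex_vector \<Rightarrow> 'c::complex_vector) \<Rightarrow> bool" where
  "cbilinear \<beta> \<longleftrightarrow> (\<forall>y. clinear (\<lambda>x. \<beta> x y)) \<and> (\<forall>x. clinear (\<beta> x))"

text \<open>The linear map on the tensor product determined by a bilinear map \<open>\<beta>\<close>; it is only
  meaningful if \<open>\<beta>\<close> is bilinear.\<close>

definition tensor_lift :: "('a::complex_vector \<Rightarrow> 'b::complex_vector \<Rightarrow> 'c::complex_vector) \<Rightarrow>
    ('a, 'b) tensor \<Rightarrow> 'c" where
  "tensor_lift \<beta> t = extend_linear (\<lambda>(x, y). \<beta> x y) (rep_tensor t)"

lemma cbilinearI:
  assumes "\<And>x x' y. \<beta> (x + x') y = \<beta> x y + \<beta> x' y" "\<And>c x y. \<beta> (c *\<^sub>C x) y = c *\<^sub>C \<beta> x y"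
    "\<And>x y y'. \<beta> x (y + y') = \<beta> x y + \<beta> x y'" "\<And>c x y. \<beta> x (c *\<^sub>C y) = c *\<^sub>C \<beta> x y"
  shows "cbilinear \<beta>"
  unfolding cbilinear_def by (auto intro!: clinearI simp: assms)

lemma cbilinearD:
  assumes "cbilinear \<beta>"
  shows "\<beta> (x + x') y = \<beta> x y + \<beta> x' y" "\<beta> (c *\<^sub>C x) y = c *\<^sub>C \<beta> x y"
    "\<beta> x (y + y') = \<beta> x y + \<beta> x y'" "\<beta> x (c *\<^sub>C y) = c *\<^sub>C \<beta> x y"
  using assms unfolding cbilinear_def Vector_Spaces.linear_iff by blast+

lemma tensor_bilinear:
  "(x + x') \<otimes> y = x \<otimes> y + x' \<otimes> y" "(c *\<^sub>C x) \<otimes> y = c *\<^sub>C (x \<otimes> y)"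
  "x \<otimes> (y + y') = x \<otimes> y + x \<otimes> y'" "x \<otimes> (c *\<^sub>C y) = c *\<^sub>C (x \<otimes> y)"
  unfolding tensor_def plus_tensor.abs_eq scaleC_tensor.abs_eq tensor.abs_eq_iff tensor_rel_def
    tensor_null_def diff_diff_eq[symmetric]
  by (rule complex_vector.span_base; blast)+

lemma tensor_lift_abs:
  assumes "cbilinear \<beta>"
  shows "tensor_lift \<beta> (abs_tensor p) = extend_linear (\<lambda>(x, y). \<beta> x y) p"
proof -
  let ?e = "extend_linear (\<lambda>(x, y). \<beta> x y)"
  interpret e: Vector_Spaces.linear "(*\<^sub>C)" "(*\<^sub>C)" ?e by (rule clinear_extend_linear)
  have null: "?e q = 0" if "q \<in> tensor_null" for q
    using that unfolding tensor_null_def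
    by (rule e.eq_0_on_span[rotated])
      (auto simp: e.diff e.scale extend_linear_single cbilinearD[OF assms] scaleC_one)
  have "tensor_rel (rep_tensor (abs_tensor p)) p"
    by (metis Quotient3_abs_rep Quotient3_tensor tensor.abs_eq_iff)
  then have "?e (rep_tensor (abs_tensor p) - p) = 0"
    by (intro null) (simp add: tensor_rel_def)
  then show ?thesis by (simp add: tensor_lift_def e.diff)
qed

lemma tensor_lift_tensor [simp]:
  assumes "cbilinear \<beta>" shows "tensor_lift \<beta> (x \<otimes> y) = \<beta> x y"
  by (simp add: tensor_def tensor_lift_abs[OF assms] extend_linear_single scaleC_one)

lemma clinear_tensor_lift:
  assumes "cbilinear \<beta>" shows "clinear (tensor_lift \<beta>)"
proof -
  interpret e: Vector_Spaces.linear "(*\<^sub>C)" "(*\<^sub>C)" "extend_linear (\<lambda>(x, y). \<beta> x y)"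
    by (rule clinear_extend_linear)
  show ?thesis
  proof (rule clinearI)
    fix s t :: "('a, 'b) tensor" and c :: complex
    show "tensor_lift \<beta> (s + t) = tensor_lift \<beta> s + tensor_lift \<beta> t"
      by (induct s rule: tensor.abs_induct, induct t rule: tensor.abs_induct)
        (simp add: plus_tensor.abs_eq tensor_lift_abs[OF assms] e.add)
    show "tensor_lift \<beta> (c *\<^sub>C s) = c *\<^sub>C tensor_lift \<beta> s"
      by (induct s rule: tensor.abs_induct)
        (simp add: scaleC_tensor.abs_eq tensor_lift_abs[OF assms] e.scale)
  qed
qed

lemma tensor_lift_add:
  "cbilinear \<beta> \<Longrightarrow> tensor_lift \<beta> (s + t) = tensor_lift \<beta> s + tensor_lift \<beta> t"
  and tensor_lift_scaleC: "cbilinear \<beta> \<Longrightarrow> tensor_lift \<beta> (c *\<^sub>C s) = c *\<^sub>C tensor_lift \<beta> s"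
  using clinear_tensor_lift unfolding Vector_Spaces.linear_iff by blast+

lemma tensor_induct [case_names tensor add]:
  fixes t :: "('a::complex_vector, 'b::complex_vector) tensor"
  assumes pure: "\<And>x y. P (x \<otimes> y)" and add: "\<And>s t. P s \<Longrightarrow> P t \<Longrightarrow> P (s + t)"
  shows "P t"
proof (induct t rule: tensor.abs_induct)
  fix p :: "'a \<times> 'b \<Rightarrow>\<^sub>0 complex"
  have abs_single: "abs_tensor (Poly_Mapping.single (x, y) c) = (c *\<^sub>C x) \<otimes> y"
    for x :: 'a and y :: 'b and c
    by (simp only: tensor_bilinear, simp add: tensor_def scaleC_tensor.abs_eq scaleC_single
        scaleC_complex_def)
  have "(0 *\<^sub>C (0::'a)) \<otimes> (0::'b) = 0"
    unfolding tensor_bilinear(2) by (rule complex_vector.scale_zero_left)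
  then have "P 0" using pure by metis
  then show "P (abs_tensor p)"
  proof (induct p rule: poly_mapping_single_induct)
    case zero then show ?case by (simp add: zero_tensor_def)
  next
    case (single k c) then show ?case by (cases k) (simp only: abs_single pure)
  next
    case (add p q) then show ?case by (metis assms(2) plus_tensor.abs_eq)
  qed
qed

instantiation tensor :: (complex_algebra, complex_algebra) complex_algebra
begin

definition one_tensor :: "('a, 'b) tensor" where "one_tensor = 1 \<otimes> 1"

definition times_tensor :: "('a, 'b) tensor \<Rightarrow> ('a, 'b) tensor \<Rightarrow> ('a, 'b) tensor" where
  "times_tensor s t = tensor_lift (\<lambda>x y. tensor_lift (\<lambda>u v. (x * u) \<otimes> (y * v)) t) s"

lemma cbilinear_mult_left: "cbilinear (\<lambda>u v. (x * u) \<otimes> (y * v))"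
  for x :: "'c::complex_algebra" and y :: "'d::complex_algebra"
  by (rule cbilinearI) (simp_all only: distrib_left mult_scaleC_right tensor_bilinear)

lemma cbilinear_mult:
  fixes t :: "('c::complex_algebra, 'd::complex_algebra) tensor"
  shows "cbilinear (\<lambda>x y. tensor_lift (\<lambda>u v. (x * u) \<otimes> (y * v)) t)"
proof (rule cbilinearI)
  note lift = tensor_lift_add[OF cbilinear_mult_left] tensor_lift_tensor[OF cbilinear_mult_left]
  note dist = distrib_right mult_scaleC_left tensor_bilinear scaleC_add_right
  fix x x' :: 'c and y y' :: 'd and c :: complex
  show "tensor_lift (\<lambda>u v. ((x + x') * u) \<otimes> (y * v)) t
      = tensor_lift (\<lambda>u v. (x * u) \<otimes> (y * v)) t + tensor_lift (\<lambda>u v. (x' * u) \<otimes> (y * v)) t"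
  proof (induct t rule: tensor_induct)
    case (tensor u v) show ?case by (simp only: lift) (simp only: dist)
  next
    case (add s t) then show ?case by (simp only: lift add_ac)
  qed
  show "tensor_lift (\<lambda>u v. (x * u) \<otimes> ((y + y') * v)) t
      = tensor_lift (\<lambda>u v. (x * u) \<otimes> (y * v)) t + tensor_lift (\<lambda>u v. (x * u) \<otimes> (y' * v)) t"
  proof (induct t rule: tensor_induct)
    case (tensor u v) show ?case by (simp only: lift) (simp only: dist)
  next
    case (add s t) then show ?case by (simp only: lift add_ac)
  qed
  show "tensor_lift (\<lambda>u v. ((c *\<^sub>C x) * u) \<otimes> (y * v)) t
      = c *\<^sub>C tensor_lift (\<lambda>u v. (x * u) \<otimes> (y * v)) t"
  proof (induct t rule: tensor_induct)
    case (tensor u v) show ?case by (simp only: lift) (simp only: dist)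
  next
    case (add s t) then show ?case by (simp only: lift scaleC_add_right)
  qed
  show "tensor_lift (\<lambda>u v. (x * u) \<otimes> ((c *\<^sub>C y) * v)) t
      = c *\<^sub>C tensor_lift (\<lambda>u v. (x * u) \<otimes> (y * v)) t"
  proof (induct t rule: tensor_induct)
    case (tensor u v) show ?case by (simp only: lift) (simp only: dist)
  next
    case (add s t) then show ?case by (simp only: lift scaleC_add_right)
  qed
qed

lemma tensor_mult_tensor: "(x \<otimes> y) * (u \<otimes> v) = (x * u) \<otimes> (y * v)" for x u :: 'a and y v :: 'b
  unfolding times_tensor_def tensor_lift_tensor[OF cbilinear_mult]
  by (rule tensor_lift_tensor[OF cbilinear_mult_left])

instance
proof
  note pure = tensor_mult_tensor
  fix r s t :: "('a, 'b) tensor" and c :: complex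
  show dl: "(r + s) * t = r * t + s * t" for r s t :: "('a, 'b) tensor"
    unfolding times_tensor_def by (rule tensor_lift_add[OF cbilinear_mult])
  show "(c *\<^sub>C s) * t = c *\<^sub>C (s * t)" for s t :: "('a, 'b) tensor"
    unfolding times_tensor_def by (rule tensor_lift_scaleC[OF cbilinear_mult])
  show dr: "r * (s + t) = r * s + r * t" for r s t :: "('a, 'b) tensor"
  proof (induct r rule: tensor_induct)
    case (tensor x y) show ?case
      unfolding times_tensor_def tensor_lift_tensor[OF cbilinear_mult]
      by (rule tensor_lift_add[OF cbilinear_mult_left])
  next
    case (add p q) then show ?case by (simp only: dl add_ac)
  qed
  show "s * (c *\<^sub>C t) = c *\<^sub>C (s * t)"
  proof (induct s rule: tensor_induct)
    case (tensor x y) show ?case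
      unfolding times_tensor_def tensor_lift_tensor[OF cbilinear_mult]
      by (rule tensor_lift_scaleC[OF cbilinear_mult_left])
  next
    case (add p q) then show ?case by (simp only: dl scaleC_add_right)
  qed
  show "1 * t = t"
    by (induct t rule: tensor_induct) (simp_all only: one_tensor_def pure dr mult_1_left)
  show "t * 1 = t"
    by (induct t rule: tensor_induct) (simp_all only: one_tensor_def pure dl mult_1_right)
  have 1: "(x \<otimes> y) * (u \<otimes> v) * t = (x \<otimes> y) * ((u \<otimes> v) * t)" for x u :: 'a and y v :: 'b
    by (induct t rule: tensor_induct) (simp_all only: pure dr mult.assoc)
  have 2: "(x \<otimes> y) * s * t = (x \<otimes> y) * (s * t)" for x :: 'a and y :: 'b
    by (induct s rule: tensor_induct) (simp_all only: 1 dr dl)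
  show "r * s * t = r * (s * t)"
    by (induct r rule: tensor_induct) (simp_all only: 2 dl)
qed

end

definition tensor_map :: "('a::complex_vector \<Rightarrow> 'c::complex_vector) \<Rightarrow>
    ('b::complex_vector \<Rightarrow> 'd::complex_vector) \<Rightarrow> ('a, 'b) tensor \<Rightarrow> ('c, 'd) tensor" where
  "tensor_map f g = tensor_lift (\<lambda>x y. f x \<otimes> g y)"

definition tensor_assoc :: "(('a::complex_vector, 'b::complex_vector) tensor, 'c::complex_vector) tensor
    \<Rightarrow> ('a, ('b, 'c) tensor) tensor" where
  "tensor_assoc = tensor_lift (\<lambda>t z. tensor_lift (\<lambda>x y. x \<otimes> (y \<otimes> z)) t)"


section \<open>Bialgebras and antipodes\<close>

locale bialgebra =
  fixes \<delta> :: "'a::complex_algebra \<Rightarrow> ('a, 'a) tensor" and \<epsilon> :: "'a \<Rightarrow> complex"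
  assumes comult_hom: "algebra_hom \<delta>"
    and counit_hom: "algebra_hom \<epsilon>"
    and coassoc: "tensor_assoc (tensor_map \<delta> id (\<delta> x)) = tensor_map id \<delta> (\<delta> x)"
    and counit_left: "tensor_lift (\<lambda>x y. \<epsilon> x *\<^sub>C y) (\<delta> x) = x"
    and counit_right: "tensor_lift (\<lambda>x y. \<epsilon> y *\<^sub>C x) (\<delta> x) = x"

definition bialgebra_hom ::
    "('a::complex_algebra \<Rightarrow> ('a, 'a) tensor) \<Rightarrow> ('a \<Rightarrow> complex) \<Rightarrow>
     ('b::complex_algebra \<Rightarrow> ('b, 'b) tensor) \<Rightarrow> ('b \<Rightarrow> complex) \<Rightarrow> ('a \<Rightarrow> 'b) \<Rightarrow> bool" where
  "bialgebra_hom \<delta>\<^sub>1 \<epsilon>\<^sub>1 \<delta>\<^sub>2 \<epsilon>\<^sub>2 f \<longleftrightarrow>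
     algebra_hom f \<and> (\<forall>x. \<delta>\<^sub>2 (f x) = tensor_map f f (\<delta>\<^sub>1 x)) \<and> (\<forall>x. \<epsilon>\<^sub>2 (f x) = \<epsilon>\<^sub>1 x)"

definition antipode ::
    "('a::complex_algebra \<Rightarrow> ('a, 'a) tensor) \<Rightarrow> ('a \<Rightarrow> complex) \<Rightarrow> ('a \<Rightarrow> 'a) \<Rightarrow> bool" where
  "antipode \<delta> \<epsilon> \<gamma> \<longleftrightarrow> clinear \<gamma> \<and>
     (\<forall>x. tensor_lift (\<lambda>x y. \<gamma> x * y) (\<delta> x) = \<epsilon> x *\<^sub>C 1) \<and>
     (\<forall>x. tensor_lift (\<lambda>x y. x * \<gamma> y) (\<delta> x) = \<epsilon> x *\<^sub>C 1)"


section \<open>The bialgebra S14o\<close>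

definition S14o_relators :: "'a::complex_algebra \<Rightarrow> 'a \<Rightarrow> 'a \<Rightarrow> 'a \<Rightarrow> 'a set" where
  "S14o_relators a b c d =
     {b * a - a * b, c * a + a * c, d * a + a * d, c * b + b * c, d * b + b * d, d * c - c * d}"

datatype S14o_gen = Gen_a | Gen_b | Gen_c | Gen_d

instantiation S14o_gen :: presentation
begin
definition relators_S14o_gen :: "S14o_gen free_algebra set" where
  "relators_S14o_gen =
     S14o_relators (free_gen Gen_a) (free_gen Gen_b) (free_gen Gen_c) (free_gen Gen_d)"
instance ..
end

type_synonym S14o = "S14o_gen presented"

definition a_til :: S14o where "a_til = gen Gen_a"
definition b_til :: S14o where "b_til = gen Gen_b"
definition c_til :: S14o where "c_til = gen Gen_c"
definition d_til :: S14o where "d_til = gen Gen_d"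

definition S14o_comult :: "S14o \<Rightarrow> (S14o, S14o) tensor" where
  "S14o_comult = presented_lift (\<lambda>g. case g of
     Gen_a \<Rightarrow> a_til \<otimes> a_til + b_til \<otimes> b_til - c_til \<otimes> c_til + d_til \<otimes> d_til
   | Gen_b \<Rightarrow> a_til \<otimes> b_til + b_til \<otimes> a_til - c_til \<otimes> d_til + d_til \<otimes> c_til
   | Gen_c \<Rightarrow> a_til \<otimes> c_til + c_til \<otimes> a_til - b_til \<otimes> d_til + d_til \<otimes> b_til
   | Gen_d \<Rightarrow> a_til \<otimes> d_til + d_til \<otimes> a_til - b_til \<otimes> c_til + c_til \<otimes> b_til)"

definition S14o_counit :: "S14o \<Rightarrow> complex" where
  "S14o_counit = presented_lift (\<lambda>g. case g of Gen_a \<Rightarrow> 1 | _ \<Rightarrow> 0)"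

definition a_hat :: S14o where "a_hat = a_til + b_til"
definition b_hat :: S14o where "b_hat = d_til - c_til"
definition c_hat :: S14o where "c_hat = c_til + d_til"
definition d_hat :: S14o where "d_hat = a_til - b_til"


section \<open>The matrix bialgebra of \<open>GL\<^sub>p\<^sub>,\<^sub>q(2)\<close> at \<open>p = q = -1\<close>\<close>

definition GLm_relators :: "'a::complex_algebra \<Rightarrow> 'a \<Rightarrow> 'a \<Rightarrow> 'a \<Rightarrow> 'a set" where
  "GLm_relators a b c d =
     {b * a + a * b, c * a + a * c, d * a - a * d, c * b - b * c, b * d + d * b, c * d + d * c}"

datatype GLm_gen = Mat_a | Mat_b | Mat_c | Mat_d

instantiation GLm_gen :: presentation
begin
definition relators_GLm_gen :: "GLm_gen free_algebra set" where
  "relators_GLm_gen =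
     GLm_relators (free_gen Mat_a) (free_gen Mat_b) (free_gen Mat_c) (free_gen Mat_d)"
instance ..
end

type_synonym GLm = "GLm_gen presented"

definition GLm_comult :: "GLm \<Rightarrow> (GLm, GLm) tensor" where
  "GLm_comult = presented_lift (\<lambda>g. case g of
     Mat_a \<Rightarrow> gen Mat_a \<otimes> gen Mat_a + gen Mat_b \<otimes> gen Mat_c
   | Mat_b \<Rightarrow> gen Mat_a \<otimes> gen Mat_b + gen Mat_b \<otimes> gen Mat_d
   | Mat_c \<Rightarrow> gen Mat_c \<otimes> gen Mat_a + gen Mat_d \<otimes> gen Mat_c
   | Mat_d \<Rightarrow> gen Mat_c \<otimes> gen Mat_b + gen Mat_d \<otimes> gen Mat_d)"

definition GLm_counit :: "GLm \<Rightarrow> complex" where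
  "GLm_counit = presented_lift (\<lambda>g. case g of Mat_a \<Rightarrow> 1 | Mat_b \<Rightarrow> 0 | Mat_c \<Rightarrow> 0 | Mat_d \<Rightarrow> 1)"


section \<open>Adjoining the inverse of the quantum determinant\<close>

definition omega :: S14o where "omega = a_hat * d_hat + b_hat * c_hat"

text \<open>The extension is presented by the generators of \<open>S14o\<close> together with \<open>\<omega>\<inverse>\<close>, subject to the
  relations of \<open>S14o\<close> and \<open>\<omega> \<omega>\<inverse> = \<omega>\<inverse> \<omega> = 1\<close>.\<close>

datatype S14o_ext_gen = Old S14o_gen | Omega_inv

definition free_omega :: "S14o_ext_gen free_algebra" where
  "free_omega =
     (let a = free_gen (Old Gen_a); b = free_gen (Old Gen_b);
          c = free_gen (Old Gen_c); d = free_gen (Old Gen_d)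
      in (a + b) * (a - b) + (d - c) * (c + d))"

instantiation S14o_ext_gen :: presentation
begin
definition relators_S14o_ext_gen :: "S14o_ext_gen free_algebra set" where
  "relators_S14o_ext_gen =
     S14o_relators (free_gen (Old Gen_a)) (free_gen (Old Gen_b))
       (free_gen (Old Gen_c)) (free_gen (Old Gen_d)) \<union>
     {free_omega * free_gen Omega_inv - 1, free_gen Omega_inv * free_omega - 1}"
instance ..
end

type_synonym S14o_ext = "S14o_ext_gen presented"

definition ext_incl :: "S14o \<Rightarrow> S14o_ext" where
  "ext_incl = presented_lift (\<lambda>g. gen (Old g))"

definition omega_inv :: S14o_ext where "omega_inv = gen Omega_inv"

definition ext_comult :: "S14o_ext \<Rightarrow> (S14o_ext, S14o_ext) tensor" where
  "ext_comult = presented_lift (\<lambda>g. case g of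
     Old h \<Rightarrow> tensor_map ext_incl ext_incl (S14o_comult (gen h))
   | Omega_inv \<Rightarrow> omega_inv \<otimes> omega_inv)"

definition ext_counit :: "S14o_ext \<Rightarrow> complex" where
  "ext_counit = presented_lift (\<lambda>g. case g of Old h \<Rightarrow> S14o_counit (gen h) | Omega_inv \<Rightarrow> 1)"

end

theory Submission
  imports Defs
begin

text \<open>The relators in the hatted generators are linear combinations of the original relators and
  conversely, so in every algebra the two sets generate the same ideal.  In terms of the hatted
  generators the coproduct is comultiplication of matrix entries, for which compatibility with the
  relations is a computation with ordered monomials, and the bialgebra axioms, being equalities of
  algebra homomorphisms, need only be checked on matrix entries.  The antipode is obtained as a
  homomorphism into the opposite algebra; since the antipode identities are stable under products,
  they reduce to the adjugate formula, using that \<open>\<omega>\<close> is central.\<close>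

section \<open>Algebra homomorphisms and presented algebras\<close>

text \<open>\<open>presented_lift\<close> evaluates at a chosen representative, so nothing can be
  said about a coproduct, counit or antipode before its values on the generators are known to
  satisfy the relations. The relators are therefore kept as functions of four elements of an
  arbitrary algebra: the same condition \<open>R \<subseteq> {0}\<close> is tested in the presented
  algebras, in tensor squares and in an opposite algebra. The value -1 of both parameters explains
  the signs. It is its own inverse, so reversing all products preserves the relations. Moving a
  matrix entry past ad or bc costs either no sign or two, which makes \<omega> central. The
  classical minus signs in determinant and adjugate become plus signs: with T the matrix of hatted
  generators and T' = (d b; c a), the off-diagonal entries of T T' are ab + ba and cd + dc, which
  vanish, and the diagonal entries ad + bc and cb + da both equal \<omega>. Returning from hatted to
  tilded generators only requires division by 2.\<close>

lemma algebra_homI: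
  assumes "\<And>x y. f (x + y) = f x + f y" "\<And>c x. f (c *\<^sub>C x) = c *\<^sub>C f x"
    and "f 1 = 1" "\<And>x y. f (x * y) = f x * f y"
  shows "algebra_hom f"
  unfolding algebra_hom_def by (intro conjI clinearI allI) (rule assms)+

lemma algebra_homD:
  assumes "algebra_hom f"
  shows "f (x + y) = f x + f y" "f (c *\<^sub>C x) = c *\<^sub>C f x" "f 1 = 1" "f (x * y) = f x * f y"
    and "f 0 = 0" "f (- x) = - f x" "f (x - y) = f x - f y"
proof -
  have lin: "clinear f" using assms by (simp add: algebra_hom_def)
  interpret Vector_Spaces.linear "(*\<^sub>C)" "(*\<^sub>C)" f by (rule lin)
  show "f (x + y) = f x + f y" "f (c *\<^sub>C x) = c *\<^sub>C f x" "f 0 = 0" "f (- x) = - f x"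
    "f (x - y) = f x - f y" by (rule add scale zero neg diff)+
  show "f 1 = 1" "f (x * y) = f x * f y" using assms by (simp_all add: algebra_hom_def)
qed

lemma algebra_hom_id: "algebra_hom id"
  by (rule algebra_homI) simp_all

lemma algebra_hom_comp:
  assumes "algebra_hom f" "algebra_hom g" shows "algebra_hom (\<lambda>x. f (g x))"
  by (rule algebra_homI) (simp_all add: algebra_homD[OF assms(1)] algebra_homD[OF assms(2)])

lemma two_sided_ideal_subset:
  assumes "R \<subseteq> two_sided_ideal S" shows "two_sided_ideal R \<subseteq> two_sided_ideal S"
proof
  fix x assume "x \<in> two_sided_ideal R"
  then show "x \<in> two_sided_ideal S"
    by induction (use assms in \<open>auto intro: two_sided_ideal.intros\<close>)
qed

text \<open>Needed because solving for the tilded relators in terms of the hatted ones produces them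
  multiplied by 2 or 4.\<close>

lemma two_sided_ideal_double:
  assumes "x + x \<in> two_sided_ideal R" shows "x \<in> two_sided_ideal R"
proof -
  have "(1/2) *\<^sub>C (x + x) = ((1/2 + 1/2)::complex) *\<^sub>C x"
    by (simp only: scaleC_add_left scaleC_add_right)
  then show ?thesis using two_sided_ideal_scaleC[OF assms, of "1/2"] by (simp add: scaleC_one)
qed

lemma algebra_hom_vanishes_on_ideal:
  assumes "algebra_hom f" "\<And>r. r \<in> R \<Longrightarrow> f r = 0" "x \<in> two_sided_ideal R"
  shows "f x = 0"
  using assms(3) by induction (simp_all add: algebra_homD[OF assms(1)] assms(2))

text \<open>Since \<open>{0}\<close> is already an ideal, an equality of generated ideals turns into
  an equivalence of relations between elements.\<close>

lemma two_sided_ideal_zero_iff: "two_sided_ideal R \<subseteq> {0} \<longleftrightarrow> R \<subseteq> {0}"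
  using algebra_hom_vanishes_on_ideal[OF algebra_hom_id, of R] by (auto intro: two_sided_ideal.base)

lemma algebra_hom_free_lift: "algebra_hom (free_lift v)"
proof -
  have lin: "clinear (free_lift v)" unfolding free_lift_def by (rule clinear_extend_linear)
  interpret Vector_Spaces.linear "(*\<^sub>C)" "(*\<^sub>C)" "free_lift v" by (rule lin)
  have single: "free_lift v (Poly_Mapping.single u c) = c *\<^sub>C prod_list (map v u)" for u c
    by (simp add: free_lift_def extend_linear_single)
  show ?thesis
  proof (rule algebra_homI)
    show "free_lift v 1 = 1"
      unfolding single_one[symmetric] by (simp add: single scaleC_one zero_list_def)
    fix p q
    have 1: "free_lift v (Poly_Mapping.single u c * q) = free_lift v (Poly_Mapping.single u c) * free_lift v q"
      for u c
      by (induct q rule: poly_mapping_single_induct)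
        (simp_all add: zero mult_single single plus_list_def scaleC_scaleC mult_scaleC_left
          mult_scaleC_right distrib_left add mult.commute)
    show "free_lift v (p * q) = free_lift v p * free_lift v q"
      by (induct p rule: poly_mapping_single_induct) (simp_all add: 1 zero distrib_right add)
  qed (rule add scale)+
qed

lemma free_lift_gen: "free_lift v (free_gen g) = v g"
  by (simp add: free_lift_def free_gen_def extend_linear_single scaleC_one)

lemma algebra_hom_abs_presented: "algebra_hom abs_presented"
  by (rule algebra_homI)
    (simp_all add: plus_presented.abs_eq scaleC_presented.abs_eq one_presented_def times_presented.abs_eq)

lemma abs_presented_eq_0_iff: "abs_presented p = 0 \<longleftrightarrow> p \<in> two_sided_ideal relators"
  by (simp add: zero_presented_def presented.abs_eq_iff presented_rel_def)

text \<open>Zero and negatives need no cases of their own, being scalar multiples. The remaining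
  cases say that \<open>P\<close> describes a subalgebra containing the generators.\<close>

lemma presented_induct [case_names gen one add scaleC mult]:
  fixes x :: "'g::presentation presented"
  assumes gen: "\<And>g. P (gen g)" and one: "P 1" and add: "\<And>x y. P x \<Longrightarrow> P y \<Longrightarrow> P (x + y)"
    and scaleC: "\<And>c x. P x \<Longrightarrow> P (c *\<^sub>C x)" and mult: "\<And>x y. P x \<Longrightarrow> P y \<Longrightarrow> P (x * y)"
  shows "P x"
proof (induct x rule: presented.abs_induct)
  note hom = algebra_homD[OF algebra_hom_abs_presented]
  have word: "P (abs_presented (Poly_Mapping.single u 1))" for u :: "'g list"
  proof (induct u)
    case Nil
    have "Poly_Mapping.single [] 1 = (1 :: 'g free_algebra)"
      by (simp flip: single_one add: zero_list_def)
    then show ?case using one by (simp add: hom)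
  next
    case (Cons g u)
    have "Poly_Mapping.single (g # u) 1 = free_gen g * Poly_Mapping.single u (1::complex)"
      by (simp add: free_gen_def mult_single plus_list_def)
    then show ?case using mult[OF gen Cons] by (simp add: hom gen_def)
  qed
  fix p :: "'g free_algebra"
  show "P (abs_presented p)"
  proof (induct p rule: poly_mapping_single_induct)
    case zero
    show ?case using scaleC[OF one, of 0] by (simp add: hom)
  next
    case (single u c)
    have "Poly_Mapping.single u c = c *\<^sub>C Poly_Mapping.single u 1"
      by (simp add: scaleC_single scaleC_complex_def)
    then show ?case using scaleC[OF word] by (simp add: hom)
  next
    case (add p q)
    then show ?case using assms(3) by (simp add: hom)
  qed
qed

text \<open>The universal property of the presentation: when the relators are killed, so is the
  ideal, and the choice of representative no longer matters.\<close>

lemma presented_lift_hom: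
  assumes "\<And>r. r \<in> relators \<Longrightarrow> free_lift v r = 0"
  shows "algebra_hom (presented_lift v)" and "presented_lift v (gen g) = v g"
proof -
  note hom = algebra_homD[OF algebra_hom_free_lift]
  have abs: "presented_lift v (abs_presented p) = free_lift v p" for p
  proof -
    have "presented_rel (rep_presented (abs_presented p)) p"
      by (metis Quotient3_abs_rep Quotient3_presented presented.abs_eq_iff)
    then have "free_lift v (rep_presented (abs_presented p) - p) = 0"
      unfolding presented_rel_def
      using algebra_hom_vanishes_on_ideal[OF algebra_hom_free_lift, of relators v] assms by blast
    then show ?thesis by (simp add: presented_lift_def hom)
  qed
  show "presented_lift v (gen g) = v g" by (simp add: gen_def abs free_lift_gen)
  show "algebra_hom (presented_lift v)"
  proof (rule algebra_homI)
    fix x y :: "'a presented" and c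
    show "presented_lift v (x + y) = presented_lift v x + presented_lift v y"
      by (induct x rule: presented.abs_induct, induct y rule: presented.abs_induct)
        (simp add: plus_presented.abs_eq abs hom)
    show "presented_lift v (x * y) = presented_lift v x * presented_lift v y"
      by (induct x rule: presented.abs_induct, induct y rule: presented.abs_induct)
        (simp add: times_presented.abs_eq abs hom)
    show "presented_lift v (c *\<^sub>C x) = c *\<^sub>C presented_lift v x"
      by (induct x rule: presented.abs_induct) (simp add: scaleC_presented.abs_eq abs hom)
    show "presented_lift v 1 = 1" by (simp add: one_presented_def abs hom)
  qed
qed


section \<open>Homomorphisms on tensor products\<close>

lemma tensor_diff_minus:
  "(- x) \<otimes> y = - (x \<otimes> y)" "x \<otimes> (- y) = - (x \<otimes> y)"
  "(x - x') \<otimes> y = x \<otimes> y - x' \<otimes> y" "x \<otimes> (y - y') = x \<otimes> y - x \<otimes> y'"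
proof -
  have l: "(- x) \<otimes> y = - (x \<otimes> y)" for x y
    using tensor_bilinear(2)[of "-1" x y] by (simp add: complex_vector.scale_minus_left scaleC_one)
  have r: "x \<otimes> (- y) = - (x \<otimes> y)" for x y
    using tensor_bilinear(4)[of x "-1" y] by (simp add: complex_vector.scale_minus_left scaleC_one)
  show "(- x) \<otimes> y = - (x \<otimes> y)" "x \<otimes> (- y) = - (x \<otimes> y)" by (rule l r)+
  show "(x - x') \<otimes> y = x \<otimes> y - x' \<otimes> y" using tensor_bilinear(1)[of x "- x'" y] by (simp add: l)
  show "x \<otimes> (y - y') = x \<otimes> y - x \<otimes> y'" using tensor_bilinear(3)[of x y "- y'"] by (simp add: r)
qed

text \<open>Multiplicativity on pure tensors suffices, by induction on each factor in turn. Tensor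
  products of homomorphisms, the associator and the contractions with a counit are all
  instances.\<close>

lemma algebra_hom_tensor_lift:
  assumes bil: "cbilinear \<beta>" and one: "\<beta> 1 1 = 1"
    and mult: "\<And>x y u v. \<beta> (x * u) (y * v) = \<beta> x y * \<beta> u v"
  shows "algebra_hom (tensor_lift \<beta>)"
proof (rule algebra_homI)
  note lift = tensor_lift_add[OF bil] tensor_lift_scaleC[OF bil] tensor_lift_tensor[OF bil]
  fix s t
  have "tensor_lift \<beta> ((x \<otimes> y) * t) = \<beta> x y * tensor_lift \<beta> t" for x y
    by (induct t rule: tensor_induct) (simp_all only: tensor_mult_tensor lift mult distrib_left)
  then show "tensor_lift \<beta> (s * t) = tensor_lift \<beta> s * tensor_lift \<beta> t"
    by (induct s rule: tensor_induct) (simp_all only: lift distrib_right)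
  show "tensor_lift \<beta> 1 = 1" by (simp only: one_tensor_def lift one)
qed (simp_all only: tensor_lift_add[OF bil] tensor_lift_scaleC[OF bil])

lemma cbilinear_tensor_map:
  assumes "algebra_hom f" "algebra_hom g" shows "cbilinear (\<lambda>x y. f x \<otimes> g y)"
  by (rule cbilinearI) (simp_all only: algebra_homD[OF assms(1)] algebra_homD[OF assms(2)] tensor_bilinear)

lemma tensor_map_tensor:
  assumes "algebra_hom f" "algebra_hom g" shows "tensor_map f g (x \<otimes> y) = f x \<otimes> g y"
  unfolding tensor_map_def by (rule tensor_lift_tensor[OF cbilinear_tensor_map[OF assms]])

lemma algebra_hom_tensor_map:
  assumes "algebra_hom f" "algebra_hom g" shows "algebra_hom (tensor_map f g)"
  unfolding tensor_map_def
  by (rule algebra_hom_tensor_lift[OF cbilinear_tensor_map[OF assms]])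
    (simp_all only: algebra_homD[OF assms(1)] algebra_homD[OF assms(2)] tensor_mult_tensor one_tensor_def)

lemma cbilinear_tensor_assoc_inner: "cbilinear (\<lambda>x y. x \<otimes> (y \<otimes> z))"
  by (rule cbilinearI) (simp_all only: tensor_bilinear)

text \<open>Linearity in \<open>t\<close> is that of \<open>tensor_lift\<close>; linearity in
  \<open>z\<close> concerns the bilinear map being lifted and needs induction on
  \<open>t\<close>.\<close>

lemma cbilinear_tensor_assoc: "cbilinear (\<lambda>t z. tensor_lift (\<lambda>x y. x \<otimes> (y \<otimes> z)) t)"
proof (rule cbilinearI)
  note lift = tensor_lift_add[OF cbilinear_tensor_assoc_inner]
    tensor_lift_scaleC[OF cbilinear_tensor_assoc_inner]
    tensor_lift_tensor[OF cbilinear_tensor_assoc_inner]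
  fix s t z z' c
  show "tensor_lift (\<lambda>x y. x \<otimes> (y \<otimes> (z + z'))) t
      = tensor_lift (\<lambda>x y. x \<otimes> (y \<otimes> z)) t + tensor_lift (\<lambda>x y. x \<otimes> (y \<otimes> z')) t"
  proof (induct t rule: tensor_induct)
    case (tensor x y) show ?case by (simp only: lift) (simp only: tensor_bilinear)
  next
    case (add s t) then show ?case by (simp only: lift add_ac)
  qed
  show "tensor_lift (\<lambda>x y. x \<otimes> (y \<otimes> (c *\<^sub>C z))) t = c *\<^sub>C tensor_lift (\<lambda>x y. x \<otimes> (y \<otimes> z)) t"
  proof (induct t rule: tensor_induct)
    case (tensor x y) show ?case by (simp only: lift) (simp only: tensor_bilinear)
  next
    case (add s t) then show ?case by (simp only: lift scaleC_add_right)
  qed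
qed (simp_all only: tensor_lift_add[OF cbilinear_tensor_assoc_inner]
    tensor_lift_scaleC[OF cbilinear_tensor_assoc_inner])

lemma tensor_assoc_tensor: "tensor_assoc ((x \<otimes> y) \<otimes> z) = x \<otimes> (y \<otimes> z)"
  unfolding tensor_assoc_def tensor_lift_tensor[OF cbilinear_tensor_assoc]
  by (rule tensor_lift_tensor[OF cbilinear_tensor_assoc_inner])

lemma algebra_hom_tensor_assoc: "algebra_hom tensor_assoc"
  unfolding tensor_assoc_def
proof (rule algebra_hom_tensor_lift[OF cbilinear_tensor_assoc])
  note lift = tensor_lift_add[OF cbilinear_tensor_assoc_inner]
    tensor_lift_tensor[OF cbilinear_tensor_assoc_inner]
  show "tensor_lift (\<lambda>x y. x \<otimes> (y \<otimes> 1)) 1 = 1"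
    unfolding one_tensor_def by (rule lift)
  fix s t :: "('a::complex_algebra, 'b::complex_algebra) tensor" and y v :: "'c::complex_algebra"
  have "tensor_lift (\<lambda>x y'. x \<otimes> (y' \<otimes> (y * v))) ((p \<otimes> q) * t)
      = (p \<otimes> (q \<otimes> y)) * tensor_lift (\<lambda>x y. x \<otimes> (y \<otimes> v)) t" for p q
    by (induct t rule: tensor_induct) (simp_all only: lift tensor_mult_tensor distrib_left)
  then show "tensor_lift (\<lambda>x y'. x \<otimes> (y' \<otimes> (y * v))) (s * t)
      = tensor_lift (\<lambda>x y'. x \<otimes> (y' \<otimes> y)) s * tensor_lift (\<lambda>x y. x \<otimes> (y \<otimes> v)) t"
    by (induct s rule: tensor_induct) (simp_all only: lift distrib_right)
qed

text \<open>Multiplicative because the values of \<epsilon> are scalars and so move past every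
  element.\<close>

lemma algebra_hom_counit_left:
  fixes \<epsilon> :: "'a::complex_algebra \<Rightarrow> complex"
  assumes "algebra_hom \<epsilon>"
  shows "cbilinear (\<lambda>x y :: 'a. \<epsilon> x *\<^sub>C y)" "algebra_hom (tensor_lift (\<lambda>x y :: 'a. \<epsilon> x *\<^sub>C y))"
proof -
  show bil: "cbilinear (\<lambda>x y :: 'a. \<epsilon> x *\<^sub>C y)"
    by (rule cbilinearI) (simp_all add: algebra_homD[OF assms] scaleC_add_left scaleC_add_right
        scaleC_scaleC scaleC_complex_def mult.commute)
  show "algebra_hom (tensor_lift (\<lambda>x y :: 'a. \<epsilon> x *\<^sub>C y))"
    by (rule algebra_hom_tensor_lift[OF bil]) (simp_all add: algebra_homD[OF assms] scaleC_one
        mult_scaleC_left mult_scaleC_right scaleC_scaleC)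
qed

lemma algebra_hom_counit_right:
  fixes \<epsilon> :: "'a::complex_algebra \<Rightarrow> complex"
  assumes "algebra_hom \<epsilon>"
  shows "cbilinear (\<lambda>x y :: 'a. \<epsilon> y *\<^sub>C x)" "algebra_hom (tensor_lift (\<lambda>x y :: 'a. \<epsilon> y *\<^sub>C x))"
proof -
  show bil: "cbilinear (\<lambda>x y :: 'a. \<epsilon> y *\<^sub>C x)"
    by (rule cbilinearI) (simp_all add: algebra_homD[OF assms] scaleC_add_left scaleC_add_right
        scaleC_scaleC scaleC_complex_def mult.commute)
  show "algebra_hom (tensor_lift (\<lambda>x y :: 'a. \<epsilon> y *\<^sub>C x))"
    by (rule algebra_hom_tensor_lift[OF bil]) (simp_all add: algebra_homD[OF assms] scaleC_one
        mult_scaleC_left mult_scaleC_right scaleC_scaleC mult.commute)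
qed


section \<open>Bialgebra axioms on generators\<close>

definition coalgebra_at ::
    "('a::complex_algebra \<Rightarrow> ('a, 'a) tensor) \<Rightarrow> ('a \<Rightarrow> complex) \<Rightarrow> 'a \<Rightarrow> bool" where
  "coalgebra_at \<delta> \<epsilon> x \<longleftrightarrow>
     tensor_assoc (tensor_map \<delta> id (\<delta> x)) = tensor_map id \<delta> (\<delta> x) \<and>
     tensor_lift (\<lambda>x y. \<epsilon> x *\<^sub>C y) (\<delta> x) = x \<and> tensor_lift (\<lambda>x y. \<epsilon> y *\<^sub>C x) (\<delta> x) = x"

lemma bialgebra_iff_coalgebra_at:
  "bialgebra \<delta> \<epsilon> \<longleftrightarrow> algebra_hom \<delta> \<and> algebra_hom \<epsilon> \<and> (\<forall>x. coalgebra_at \<delta> \<epsilon> x)"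
  by (auto simp: bialgebra_def coalgebra_at_def)

text \<open>Each condition equates two algebra homomorphisms at \<open>x\<close>, and the equalizer
  of two homomorphisms is a subalgebra.\<close>

lemma coalgebra_at_closed:
  assumes \<delta>: "algebra_hom \<delta>" and \<epsilon>: "algebra_hom \<epsilon>"
  shows "coalgebra_at \<delta> \<epsilon> 1"
    and "coalgebra_at \<delta> \<epsilon> x \<Longrightarrow> coalgebra_at \<delta> \<epsilon> y \<Longrightarrow> coalgebra_at \<delta> \<epsilon> (x + y)"
    and "coalgebra_at \<delta> \<epsilon> x \<Longrightarrow> coalgebra_at \<delta> \<epsilon> (c *\<^sub>C x)"
    and "coalgebra_at \<delta> \<epsilon> x \<Longrightarrow> coalgebra_at \<delta> \<epsilon> y \<Longrightarrow> coalgebra_at \<delta> \<epsilon> (x * y)"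
  unfolding coalgebra_at_def
  by (simp_all only: algebra_homD[OF \<delta>] algebra_homD[OF algebra_hom_counit_left(2)[OF \<epsilon>]]
      algebra_homD[OF algebra_hom_counit_right(2)[OF \<epsilon>]] algebra_homD[OF algebra_hom_tensor_assoc]
      algebra_homD[OF algebra_hom_tensor_map[OF \<delta> algebra_hom_id]]
      algebra_homD[OF algebra_hom_tensor_map[OF algebra_hom_id \<delta>]])

text \<open>For the matrix T = (a b; c d) this is \<delta>(t_ij) = sum over k of t_ik \<otimes>
  t_kj, the dual of matrix multiplication.\<close>

definition matrix_comult ::
    "('a::complex_algebra \<Rightarrow> ('a, 'a) tensor) \<Rightarrow> 'a \<Rightarrow> 'a \<Rightarrow> 'a \<Rightarrow> 'a \<Rightarrow> bool" where
  "matrix_comult \<delta> a b c d \<longleftrightarrow>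
     \<delta> a = a \<otimes> a + b \<otimes> c \<and> \<delta> b = a \<otimes> b + b \<otimes> d \<and>
     \<delta> c = c \<otimes> a + d \<otimes> c \<and> \<delta> d = c \<otimes> b + d \<otimes> d"

text \<open>Dual to associativity of the matrix product: both sides of coassociativity expand to the
  sum over k and l of t_ik \<otimes> t_kl \<otimes> t_lj. The counit axioms are multiplication by
  the identity matrix.\<close>

lemma coalgebra_at_matrix:
  assumes \<delta>: "algebra_hom \<delta>" and \<epsilon>: "algebra_hom \<epsilon>"
    and com: "matrix_comult \<delta> a b c d"
    and cou: "\<epsilon> a = 1" "\<epsilon> b = 0" "\<epsilon> c = 0" "\<epsilon> d = 1"
  shows "coalgebra_at \<delta> \<epsilon> a" "coalgebra_at \<delta> \<epsilon> b" "coalgebra_at \<delta> \<epsilon> c" "coalgebra_at \<delta> \<epsilon> d"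
proof -
  note maps = tensor_map_tensor[OF \<delta> algebra_hom_id] tensor_map_tensor[OF algebra_hom_id \<delta>]
    tensor_lift_tensor[OF algebra_hom_counit_left(1)[OF \<epsilon>]]
    tensor_lift_tensor[OF algebra_hom_counit_right(1)[OF \<epsilon>]]
  note homs = algebra_homD(1)[OF algebra_hom_counit_left(2)[OF \<epsilon>]]
    algebra_homD(1)[OF algebra_hom_counit_right(2)[OF \<epsilon>]]
    algebra_homD(1)[OF algebra_hom_tensor_assoc]
    algebra_homD(1)[OF algebra_hom_tensor_map[OF \<delta> algebra_hom_id]]
    algebra_homD(1)[OF algebra_hom_tensor_map[OF algebra_hom_id \<delta>]]
  note com' = com[unfolded matrix_comult_def]
  show "coalgebra_at \<delta> \<epsilon> a" "coalgebra_at \<delta> \<epsilon> b" "coalgebra_at \<delta> \<epsilon> c" "coalgebra_at \<delta> \<epsilon> d"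
    unfolding coalgebra_at_def
    by (simp_all only: com' homs maps id_apply tensor_bilinear tensor_assoc_tensor cou add_ac simp_thms
        scaleC_one complex_vector.scale_zero_left add_0_left add_0_right)
qed

definition antipode_at ::
    "('a::complex_algebra \<Rightarrow> ('a, 'a) tensor) \<Rightarrow> ('a \<Rightarrow> complex) \<Rightarrow> ('a \<Rightarrow> 'a) \<Rightarrow> 'a \<Rightarrow> bool" where
  "antipode_at \<delta> \<epsilon> \<gamma> x \<longleftrightarrow>
     tensor_lift (\<lambda>x y. \<gamma> x * y) (\<delta> x) = \<epsilon> x *\<^sub>C 1 \<and> tensor_lift (\<lambda>x y. x * \<gamma> y) (\<delta> x) = \<epsilon> x *\<^sub>C 1"

lemma cbilinear_antipode:
  fixes \<gamma> :: "'a::complex_algebra \<Rightarrow> 'a"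
  assumes "clinear \<gamma>"
  shows "cbilinear (\<lambda>x y. \<gamma> x * y)" "cbilinear (\<lambda>x y. x * \<gamma> y)"
proof -
  interpret Vector_Spaces.linear "(*\<^sub>C)" "(*\<^sub>C)" \<gamma> by (rule assms)
  show "cbilinear (\<lambda>x y. \<gamma> x * y)" "cbilinear (\<lambda>x y. x * \<gamma> y)"
    by (rule cbilinearI; simp add: add scale distrib_left distrib_right mult_scaleC_left mult_scaleC_right)+
qed

text \<open>The contractions with \<gamma> are not homomorphisms, so the equalizer argument fails
  for products. Instead, in Sweedler notation, \<gamma>(x1 y1) x2 y2 = \<gamma>(y1) (\<gamma>(x1)
  x2) y2, and the inner contraction is the scalar \<epsilon>(x), which moves out.\<close>

lemma antipode_at_closed:
  fixes \<delta> :: "'a::complex_algebra \<Rightarrow> ('a, 'a) tensor"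
  assumes \<delta>: "algebra_hom \<delta>" and \<epsilon>: "algebra_hom \<epsilon>"
    and \<gamma>: "clinear \<gamma>" "\<gamma> 1 = 1" "\<And>x y. \<gamma> (x * y) = \<gamma> y * \<gamma> x"
  shows "antipode_at \<delta> \<epsilon> \<gamma> 1"
    and "antipode_at \<delta> \<epsilon> \<gamma> x \<Longrightarrow> antipode_at \<delta> \<epsilon> \<gamma> y \<Longrightarrow> antipode_at \<delta> \<epsilon> \<gamma> (x + y)"
    and "antipode_at \<delta> \<epsilon> \<gamma> x \<Longrightarrow> antipode_at \<delta> \<epsilon> \<gamma> (c *\<^sub>C x)"
    and "antipode_at \<delta> \<epsilon> \<gamma> x \<Longrightarrow> antipode_at \<delta> \<epsilon> \<gamma> y \<Longrightarrow> antipode_at \<delta> \<epsilon> \<gamma> (x * y)"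
proof -
  let ?L = "tensor_lift (\<lambda>x y. \<gamma> x * y)" and ?R = "tensor_lift (\<lambda>x y. x * \<gamma> y)"
  note bil = cbilinear_antipode[OF \<gamma>(1)]
  note lift = bil[THEN tensor_lift_add] bil[THEN tensor_lift_scaleC] bil[THEN tensor_lift_tensor]
  show "antipode_at \<delta> \<epsilon> \<gamma> 1"
    by (simp add: antipode_at_def algebra_homD[OF \<delta>] algebra_homD[OF \<epsilon>] one_tensor_def lift \<gamma> scaleC_one)
  show "antipode_at \<delta> \<epsilon> \<gamma> x \<Longrightarrow> antipode_at \<delta> \<epsilon> \<gamma> y \<Longrightarrow> antipode_at \<delta> \<epsilon> \<gamma> (x + y)"
    by (simp add: antipode_at_def algebra_homD[OF \<delta>] algebra_homD[OF \<epsilon>] lift scaleC_add_left)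
  show "antipode_at \<delta> \<epsilon> \<gamma> x \<Longrightarrow> antipode_at \<delta> \<epsilon> \<gamma> (c *\<^sub>C x)"
    by (simp add: antipode_at_def algebra_homD[OF \<delta>] algebra_homD[OF \<epsilon>] lift scaleC_scaleC scaleC_complex_def)
  have L: "?L (s * t) = e *\<^sub>C ?L t" if "?L s = e *\<^sub>C 1" for s t e
  proof (induct t rule: tensor_induct)
    case (tensor u v)
    \<comment> \<open>Proved for every \<open>s\<close> before the assumption on \<open>?L s\<close>
      is used, since that assumption is not inherited by the summands of \<open>s\<close>.\<close>
    have "?L (s * (u \<otimes> v)) = \<gamma> u * ?L s * v"
      by (induct s rule: tensor_induct)
        (simp_all only: tensor_mult_tensor lift \<gamma>(3) mult.assoc distrib_left distrib_right)
    then show ?case by (simp add: that lift mult_scaleC_left mult_scaleC_right)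
  next
    case (add s t) then show ?case by (simp only: lift distrib_left scaleC_add_right)
  qed
  \<comment> \<open>The mirror image x1 (y1 \<gamma>(y2)) \<gamma>(x2): here the second factor
    supplies the inner scalar.\<close>
  have R: "?R (s * t) = e *\<^sub>C ?R s" if "?R t = e *\<^sub>C 1" for s t e
  proof (induct s rule: tensor_induct)
    case (tensor u v)
    have "?R ((u \<otimes> v) * t) = u * ?R t * \<gamma> v"
      by (induct t rule: tensor_induct)
        (simp_all only: tensor_mult_tensor lift \<gamma>(3) mult.assoc distrib_left distrib_right)
    then show ?case by (simp add: that lift mult_scaleC_left mult_scaleC_right)
  next
    case (add s t) then show ?case by (simp only: lift distrib_right scaleC_add_right)
  qed
  show "antipode_at \<delta> \<epsilon> \<gamma> (x * y)" if "antipode_at \<delta> \<epsilon> \<gamma> x" "antipode_at \<delta> \<epsilon> \<gamma> y"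
    using that unfolding antipode_at_def
    by (simp add: algebra_homD[OF \<delta>] algebra_homD[OF \<epsilon>] L[of _ "\<epsilon> x"] R[of _ "\<epsilon> y"] scaleC_scaleC mult.commute)
qed


section \<open>The two sets of relations\<close>

lemma algebra_hom_relators:
  assumes "algebra_hom f"
  shows "f ` S14o_relators a b c d = S14o_relators (f a) (f b) (f c) (f d)"
    and "f ` GLm_relators a b c d = GLm_relators (f a) (f b) (f c) (f d)"
  unfolding S14o_relators_def GLm_relators_def
  by (simp_all add: algebra_homD[OF assms])

lemma GLm_relators_subset_ideal:
  "GLm_relators (a + b) (d - c) (c + d) (a - b) \<subseteq> two_sided_ideal (S14o_relators a b c d)"
proof -
  let ?I = "two_sided_ideal (S14o_relators a b c d)"
  note [intro] = two_sided_ideal.add two_sided_ideal_diff two_sided_ideal_uminus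
  define s1 s2 s3 s4 s5 s6 where s: "s1 = b * a - a * b" "s2 = c * a + a * c" "s3 = d * a + a * d"
    "s4 = c * b + b * c" "s5 = d * b + b * d" "s6 = d * c - c * d"
  have "s1 \<in> ?I" "s2 \<in> ?I" "s3 \<in> ?I" "s4 \<in> ?I" "s5 \<in> ?I" "s6 \<in> ?I"
    unfolding s by (rule two_sided_ideal.base, simp add: S14o_relators_def)+
  \<comment> \<open>The six expressions are the expansions of the hatted relators, in the order of
    \<open>GLm_relators\<close>.\<close>
  then have "s3 - s2 + s5 - s4 \<in> ?I" "s2 + s3 + s4 + s5 \<in> ?I" "- (s1 + s1) \<in> ?I"
    "- (s6 + s6) \<in> ?I" "s3 - s2 - s5 + s4 \<in> ?I" "s2 + s3 - s4 - s5 \<in> ?I"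
    by blast+
  then show ?thesis unfolding GLm_relators_def s by (simp add: algebra_simps)
qed

lemma S14o_relators_subset_ideal:
  "S14o_relators a b c d \<subseteq> two_sided_ideal (GLm_relators (a + b) (d - c) (c + d) (a - b))"
proof -
  let ?I = "two_sided_ideal (GLm_relators (a + b) (d - c) (c + d) (a - b))"
  note [intro] = two_sided_ideal.add two_sided_ideal_diff two_sided_ideal_uminus
  define g1 g2 g3 g4 g5 g6 where g: "g1 = (d - c) * (a + b) + (a + b) * (d - c)"
    "g2 = (c + d) * (a + b) + (a + b) * (c + d)" "g3 = (a - b) * (a + b) - (a + b) * (a - b)"
    "g4 = (c + d) * (d - c) - (d - c) * (c + d)" "g5 = (d - c) * (a - b) + (a - b) * (d - c)"
    "g6 = (c + d) * (a - b) + (a - b) * (c + d)"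
  have "g1 \<in> ?I" "g2 \<in> ?I" "g3 \<in> ?I" "g4 \<in> ?I" "g5 \<in> ?I" "g6 \<in> ?I"
    unfolding g by (rule two_sided_ideal.base, simp add: GLm_relators_def)+
  then have *: "- g3 \<in> ?I" "- g4 \<in> ?I" "g2 - g1 + g6 - g5 \<in> ?I" "g1 + g2 + g5 + g6 \<in> ?I"
    "g2 - g1 - g6 + g5 \<in> ?I" "g1 + g2 - g5 - g6 \<in> ?I"
    by blast+
  \<comment> \<open>The commutators \<open>g3\<close> and \<open>g4\<close> are each -2 times one
    original relator. The other four are related to the four anticommutators by a matrix of signs
    with orthogonal rows, so inverting it gives a factor 4, written as a double doubling to match
    \<open>two_sided_ideal_double\<close>.\<close>
  have "- g3 = (b * a - a * b) + (b * a - a * b)" "- g4 = (d * c - c * d) + (d * c - c * d)"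
    "g2 - g1 + g6 - g5 = ((c * a + a * c) + (c * a + a * c)) + ((c * a + a * c) + (c * a + a * c))"
    "g1 + g2 + g5 + g6 = ((d * a + a * d) + (d * a + a * d)) + ((d * a + a * d) + (d * a + a * d))"
    "g2 - g1 - g6 + g5 = ((c * b + b * c) + (c * b + b * c)) + ((c * b + b * c) + (c * b + b * c))"
    "g1 + g2 - g5 - g6 = ((d * b + b * d) + (d * b + b * d)) + ((d * b + b * d) + (d * b + b * d))"
    unfolding g by (simp_all add: algebra_simps)
  note * = *[unfolded this]
  show ?thesis unfolding S14o_relators_def
    using *(1,2)[THEN two_sided_ideal_double]
      *(3-6)[THEN two_sided_ideal_double, THEN two_sided_ideal_double] by simp
qed

lemma ideal_S14o_eq_GLm:
  "two_sided_ideal (S14o_relators a b c d)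
    = two_sided_ideal (GLm_relators (a + b) (d - c) (c + d) (a - b))"
  by (intro equalityI two_sided_ideal_subset S14o_relators_subset_ideal GLm_relators_subset_ideal)

lemma S14o_relations_iff_GLm:
  "S14o_relators a b c d \<subseteq> {0} \<longleftrightarrow> GLm_relators (a + b) (d - c) (c + d) (a - b) \<subseteq> {0}"
  by (metis ideal_S14o_eq_GLm two_sided_ideal_zero_iff)

lemma S14o_relations_iff:
  "S14o_relators a b c d \<subseteq> {0} \<longleftrightarrow> b * a = a * b \<and> c * a = - (a * c) \<and> d * a = - (a * d) \<and>
     c * b = - (b * c) \<and> d * b = - (b * d) \<and> d * c = c * d"
  by (simp add: S14o_relators_def eq_neg_iff_add_eq_0)

lemma GLm_relations_iff:
  "GLm_relators a b c d \<subseteq> {0} \<longleftrightarrow> b * a = - (a * b) \<and> c * a = - (a * c) \<and> d * a = a * d \<and>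
     c * b = b * c \<and> b * d = - (d * b) \<and> c * d = - (d * c)"
  by (simp add: GLm_relators_def eq_neg_iff_add_eq_0)

text \<open>The relations as rewrite rules towards the ordered monomials \<open>a\<^sup>i b\<^sup>j c\<^sup>k d\<^sup>l\<close>.\<close>

lemma GLm_relations_ordered:
  assumes "GLm_relators a b c d \<subseteq> {0}"
  shows "b * a = - (a * b)" "c * a = - (a * c)" "d * a = a * d" "c * b = b * c"
    "d * b = - (b * d)" "d * c = - (c * d)"
    "b * (a * x) = - (a * (b * x))" "c * (a * x) = - (a * (c * x))" "d * (a * x) = a * (d * x)"
    "c * (b * x) = b * (c * x)" "d * (b * x) = - (b * (d * x))" "d * (c * x) = - (c * (d * x))"
proof -
  show *: "b * a = - (a * b)" "c * a = - (a * c)" "d * a = a * d" "c * b = b * c"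
    "d * b = - (b * d)" "d * c = - (c * d)" using assms unfolding GLm_relations_iff by simp_all
  show "b * (a * x) = - (a * (b * x))" "c * (a * x) = - (a * (c * x))" "d * (a * x) = a * (d * x)"
    "c * (b * x) = b * (c * x)" "d * (b * x) = - (b * (d * x))" "d * (c * x) = - (c * (d * x))"
    by (simp_all add: * flip: mult.assoc)
qed

text \<open>Every product of entries is a sum of tensors with one quadratic monomial in each leg, so
  reordering each leg by the six quadratic rules decides all the identities. The second part makes
  the determinant group-like.\<close>

lemma GLm_relations_matrix:
  assumes "GLm_relators a b c d \<subseteq> {0}"
  shows "GLm_relators (a \<otimes> a + b \<otimes> c) (a \<otimes> b + b \<otimes> d) (c \<otimes> a + d \<otimes> c) (c \<otimes> b + d \<otimes> d) \<subseteq> {0}"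
    and "(a \<otimes> a + b \<otimes> c) * (c \<otimes> b + d \<otimes> d) + (a \<otimes> b + b \<otimes> d) * (c \<otimes> a + d \<otimes> c)
      = (a * d + b * c) \<otimes> (a * d + b * c)"
  by (simp_all add: GLm_relators_def algebra_simps tensor_mult_tensor tensor_diff_minus
      tensor_bilinear GLm_relations_ordered(1-6)[OF assms])

text \<open>Each entry commutes with ad and with bc separately: it meets either no sign or
  two.\<close>

lemma GLm_det_central:
  assumes "GLm_relators a b c d \<subseteq> {0}" "x \<in> {a, b, c, d}"
  shows "(a * d + b * c) * x = x * (a * d + b * c)"
  using assms(2) by (auto simp: distrib_left distrib_right mult.assoc GLm_relations_ordered[OF assms(1)])

text \<open>The relations are invariant under exchanging \<open>a\<close> and \<open>d\<close>, and
  each relator is quadratic, so \<open>z\<close> comes out as a common left factor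
  \<open>z * z\<close>.\<close>

lemma GLm_relations_adjugate:
  assumes "GLm_relators a b c d \<subseteq> {0}" "\<And>x. x \<in> {a, b, c, d} \<Longrightarrow> x * z = z * x"
  shows "GLm_relators (z * d) (z * b) (z * c) (z * a) \<subseteq> {0}"
proof -
  have mult: "(z * x) * (z * y) = z * (z * (x * y))" if "x \<in> {a, b, c, d}" for x y
    using assms(2)[OF that] by (metis mult.assoc)
  show ?thesis
    by (simp add: GLm_relations_iff mult GLm_relations_ordered(1-6)[OF assms(1)])
qed


section \<open>Opposite algebras\<close>

text \<open>A type class fixes one multiplication per type, so the reversed product needs a wrapper
  type; \<open>presented_lift\<close> into it yields antihomomorphisms.\<close>

datatype 'a opp = Opp (unopp: 'a)

lemma opp_eq_iff: "x = y \<longleftrightarrow> unopp x = unopp y"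
  by (cases x; cases y) simp

instantiation opp :: (complex_algebra) complex_algebra
begin
definition zero_opp :: "'a opp" where "zero_opp = Opp 0"
definition one_opp :: "'a opp" where "one_opp = Opp 1"
definition plus_opp :: "'a opp \<Rightarrow> 'a opp \<Rightarrow> 'a opp" where "plus_opp x y = Opp (unopp x + unopp y)"
definition uminus_opp :: "'a opp \<Rightarrow> 'a opp" where "uminus_opp x = Opp (- unopp x)"
definition minus_opp :: "'a opp \<Rightarrow> 'a opp \<Rightarrow> 'a opp" where "minus_opp x y = Opp (unopp x - unopp y)"
definition times_opp :: "'a opp \<Rightarrow> 'a opp \<Rightarrow> 'a opp" where "times_opp x y = Opp (unopp y * unopp x)"
definition scaleC_opp :: "complex \<Rightarrow> 'a opp \<Rightarrow> 'a opp" where "scaleC_opp c x = Opp (c *\<^sub>C unopp x)"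
instance
  by standard (simp_all add: zero_opp_def one_opp_def plus_opp_def uminus_opp_def minus_opp_def
      times_opp_def scaleC_opp_def algebra_simps scaleC_add_left scaleC_add_right scaleC_scaleC
      scaleC_one mult_scaleC_left mult_scaleC_right)
end

lemma unopp_simps:
  "unopp 0 = 0" "unopp 1 = 1" "unopp (x + y) = unopp x + unopp y" "unopp (- x) = - unopp x"
  "unopp (x - y) = unopp x - unopp y" "unopp (x * y) = unopp y * unopp x"
  "unopp (c *\<^sub>C x) = c *\<^sub>C unopp x"
  by (simp_all add: zero_opp_def one_opp_def plus_opp_def uminus_opp_def minus_opp_def
      times_opp_def scaleC_opp_def)

text \<open>Reversing products sends every relator to itself or to its negative.\<close>

lemma GLm_relations_opp:
  "GLm_relators (Opp a) (Opp b) (Opp c) (Opp d) \<subseteq> {0} \<longleftrightarrow> GLm_relators a b c d \<subseteq> {0}"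
  by (auto simp: GLm_relators_def opp_eq_iff unopp_simps add.commute)


section \<open>The bialgebras \<open>GLm\<close> and \<open>S14o\<close>\<close>

lemma GLm_relations: "GLm_relators (gen Mat_a) (gen Mat_b) (gen Mat_c) (gen Mat_d) \<subseteq> {0}"
  unfolding gen_def algebra_hom_relators(2)[OF algebra_hom_abs_presented, symmetric]
  by (auto simp: abs_presented_eq_0_iff relators_GLm_gen_def intro: two_sided_ideal.base)

lemma S14o_relations: "S14o_relators a_til b_til c_til d_til \<subseteq> {0}"
  unfolding a_til_def b_til_def c_til_def d_til_def gen_def
    algebra_hom_relators(1)[OF algebra_hom_abs_presented, symmetric]
  by (auto simp: abs_presented_eq_0_iff relators_S14o_gen_def intro: two_sided_ideal.base)

lemma hat_relations: "GLm_relators a_hat b_hat c_hat d_hat \<subseteq> {0}"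
  using S14o_relations unfolding S14o_relations_iff_GLm a_hat_def b_hat_def c_hat_def d_hat_def .

lemma GLm_lift_hom:
  assumes "GLm_relators (v Mat_a) (v Mat_b) (v Mat_c) (v Mat_d) \<subseteq> {0}"
  shows "algebra_hom (presented_lift v)" and "presented_lift v (gen g) = v g"
proof -
  have "free_lift v ` relators = GLm_relators (v Mat_a) (v Mat_b) (v Mat_c) (v Mat_d)"
    by (simp add: relators_GLm_gen_def algebra_hom_relators[OF algebra_hom_free_lift] free_lift_gen)
  then have "free_lift v r = 0" if "r \<in> relators" for r using assms that by blast
  then show "algebra_hom (presented_lift v)" "presented_lift v (gen g) = v g"
    using presented_lift_hom by blast+
qed

lemma S14o_lift_hom:
  assumes "S14o_relators (v Gen_a) (v Gen_b) (v Gen_c) (v Gen_d) \<subseteq> {0}"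
  shows "algebra_hom (presented_lift v)" and "presented_lift v (gen g) = v g"
proof -
  have "free_lift v ` relators = S14o_relators (v Gen_a) (v Gen_b) (v Gen_c) (v Gen_d)"
    by (simp add: relators_S14o_gen_def algebra_hom_relators[OF algebra_hom_free_lift] free_lift_gen)
  then have "free_lift v r = 0" if "r \<in> relators" for r using assms that by blast
  then show "algebra_hom (presented_lift v)" "presented_lift v (gen g) = v g"
    using presented_lift_hom by blast+
qed

lemma GLm_comult_hom: "algebra_hom GLm_comult"
  and GLm_comult_gen: "matrix_comult GLm_comult (gen Mat_a) (gen Mat_b) (gen Mat_c) (gen Mat_d)"
proof -
  note lift = GLm_lift_hom[of "case_GLm_gen
      (gen Mat_a \<otimes> gen Mat_a + gen Mat_b \<otimes> gen Mat_c) (gen Mat_a \<otimes> gen Mat_b + gen Mat_b \<otimes> gen Mat_d)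
      (gen Mat_c \<otimes> gen Mat_a + gen Mat_d \<otimes> gen Mat_c) (gen Mat_c \<otimes> gen Mat_b + gen Mat_d \<otimes> gen Mat_d)",
      simplified, OF GLm_relations_matrix(1)[OF GLm_relations], folded GLm_comult_def]
  show "algebra_hom GLm_comult" by (rule lift)
  show "matrix_comult GLm_comult (gen Mat_a) (gen Mat_b) (gen Mat_c) (gen Mat_d)"
    by (simp add: matrix_comult_def lift(2))
qed

lemma GLm_counit_hom: "algebra_hom GLm_counit"
  and GLm_counit_gen: "GLm_counit (gen Mat_a) = 1" "GLm_counit (gen Mat_b) = 0"
    "GLm_counit (gen Mat_c) = 0" "GLm_counit (gen Mat_d) = 1"
proof -
  have "GLm_relators 1 0 0 (1::complex) \<subseteq> {0}" by (simp add: GLm_relators_def)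
  note lift = GLm_lift_hom[of "case_GLm_gen 1 0 0 1", simplified, OF this, folded GLm_counit_def]
  show "algebra_hom GLm_counit" by (rule lift)
  show "GLm_counit (gen Mat_a) = 1" "GLm_counit (gen Mat_b) = 0"
    "GLm_counit (gen Mat_c) = 0" "GLm_counit (gen Mat_d) = 1" by (simp_all add: lift(2))
qed

lemma bialgebra_GLm: "bialgebra GLm_comult GLm_counit"
  unfolding bialgebra_iff_coalgebra_at
proof (intro conjI allI)
  note hom = GLm_comult_hom GLm_counit_hom
  show "algebra_hom GLm_comult" "algebra_hom GLm_counit" by (rule hom)+
  fix x show "coalgebra_at GLm_comult GLm_counit x"
  proof (induct x rule: presented_induct)
    case (gen g)
    show ?case
      using coalgebra_at_matrix[OF hom GLm_comult_gen GLm_counit_gen] by (cases g) simp_all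
  qed (rule coalgebra_at_closed[OF hom]; assumption)+
qed

section \<open>Change of generators in S14o and its coproduct\<close>

lemma half_sum:
  "(1/2) *\<^sub>C ((x + y) + (x - y)) = x" "(1/2) *\<^sub>C ((x + y) - (x - y)) = y"
  for x :: "'a::complex_vector"
proof -
  have half: "(1/2) *\<^sub>C (x + x) = x" for x :: 'a
    by (simp add: scaleC_add_right scaleC_one flip: scaleC_add_left)
  show "(1/2) *\<^sub>C ((x + y) + (x - y)) = x" "(1/2) *\<^sub>C ((x + y) - (x - y)) = y"
    using half by simp_all
qed

lemma til_hat:
  "a_til = (1/2) *\<^sub>C (a_hat + d_hat)" "b_til = (1/2) *\<^sub>C (a_hat - d_hat)"
  "c_til = (1/2) *\<^sub>C (c_hat - b_hat)" "d_til = (1/2) *\<^sub>C (c_hat + b_hat)"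
  using half_sum[of a_til b_til] half_sum[of d_til c_til]
  by (simp_all add: a_hat_def b_hat_def c_hat_def d_hat_def add.commute)

text \<open>The hatted elements also generate S14o, so claims can be checked where the coproduct has
  matrix form.\<close>

lemma S14o_induct_hat [case_names a_hat b_hat c_hat d_hat one add scaleC mult]:
  assumes hat: "P a_hat" "P b_hat" "P c_hat" "P d_hat" and one: "P 1"
    and add: "\<And>x y. P x \<Longrightarrow> P y \<Longrightarrow> P (x + y)"
    and scaleC: "\<And>c x. P x \<Longrightarrow> P (c *\<^sub>C x)" and mult: "\<And>x y. P x \<Longrightarrow> P y \<Longrightarrow> P (x * y)"
  shows "P x"
proof (induct x rule: presented_induct)
  case (gen g)
  have diff: "P (x - y)" if "P x" "P y" for x y
    using add[OF that(1) scaleC[OF that(2), of "-1"]]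
    by (simp add: complex_vector.scale_minus_left scaleC_one)
  have "P a_til" "P b_til" "P c_til" "P d_til"
    unfolding til_hat by (intro scaleC add diff hat)+
  then show ?case by (cases g) (simp_all add: a_til_def b_til_def c_til_def d_til_def)
qed (rule one add scaleC mult; assumption)+

lemma S14o_hom_eqI:
  fixes f g :: "S14o \<Rightarrow> 'a::complex_algebra"
  assumes f: "algebra_hom f" and g: "algebra_hom g"
    and "f a_hat = g a_hat" "f b_hat = g b_hat" "f c_hat = g c_hat" "f d_hat = g d_hat"
  shows "f x = g x"
  by (induct x rule: S14o_induct_hat) (simp_all add: algebra_homD[OF f] algebra_homD[OF g] assms(3-))

text \<open>The source of the tilded coproduct: its sums and differences are the matrix coproduct of
  the hatted elements. Read from right to left it proves that the coproduct respects the relations;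
  read from left to right it gives the coproduct of the hatted generators.\<close>

lemma til_matrix_comult:
  "(a + b) \<otimes> (a + b) + (d - c) \<otimes> (c + d)
    = (a \<otimes> a + b \<otimes> b - c \<otimes> c + d \<otimes> d) + (a \<otimes> b + b \<otimes> a - c \<otimes> d + d \<otimes> c)"
  "(a + b) \<otimes> (d - c) + (d - c) \<otimes> (a - b)
    = (a \<otimes> d + d \<otimes> a - b \<otimes> c + c \<otimes> b) - (a \<otimes> c + c \<otimes> a - b \<otimes> d + d \<otimes> b)"
  "(c + d) \<otimes> (a + b) + (a - b) \<otimes> (c + d)
    = (a \<otimes> c + c \<otimes> a - b \<otimes> d + d \<otimes> b) + (a \<otimes> d + d \<otimes> a - b \<otimes> c + c \<otimes> b)"
  "(c + d) \<otimes> (d - c) + (a - b) \<otimes> (a - b)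
    = (a \<otimes> a + b \<otimes> b - c \<otimes> c + d \<otimes> d) - (a \<otimes> b + b \<otimes> a - c \<otimes> d + d \<otimes> c)"
  by (simp_all add: tensor_bilinear tensor_diff_minus algebra_simps)

lemma S14o_comult_hom: "algebra_hom S14o_comult"
  and S14o_comult_til:
    "S14o_comult a_til = a_til \<otimes> a_til + b_til \<otimes> b_til - c_til \<otimes> c_til + d_til \<otimes> d_til"
    "S14o_comult b_til = a_til \<otimes> b_til + b_til \<otimes> a_til - c_til \<otimes> d_til + d_til \<otimes> c_til"
    "S14o_comult c_til = a_til \<otimes> c_til + c_til \<otimes> a_til - b_til \<otimes> d_til + d_til \<otimes> b_til"
    "S14o_comult d_til = a_til \<otimes> d_til + d_til \<otimes> a_til - b_til \<otimes> c_til + c_til \<otimes> b_til"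
proof -
  have "S14o_relators (a_til \<otimes> a_til + b_til \<otimes> b_til - c_til \<otimes> c_til + d_til \<otimes> d_til)
      (a_til \<otimes> b_til + b_til \<otimes> a_til - c_til \<otimes> d_til + d_til \<otimes> c_til)
      (a_til \<otimes> c_til + c_til \<otimes> a_til - b_til \<otimes> d_til + d_til \<otimes> b_til)
      (a_til \<otimes> d_til + d_til \<otimes> a_til - b_til \<otimes> c_til + c_til \<otimes> b_til) \<subseteq> {0}"
    \<comment> \<open>The change of variables is applied inside the tensor square, where the hatted
      combinations of the four values are the entries of the matrix coproduct.\<close>
    unfolding S14o_relations_iff_GLm til_matrix_comult[symmetric]
    by (rule GLm_relations_matrix(1)[OF S14o_relations[unfolded S14o_relations_iff_GLm]])
  note lift = S14o_lift_hom[of "case_S14o_gen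
      (a_til \<otimes> a_til + b_til \<otimes> b_til - c_til \<otimes> c_til + d_til \<otimes> d_til)
      (a_til \<otimes> b_til + b_til \<otimes> a_til - c_til \<otimes> d_til + d_til \<otimes> c_til)
      (a_til \<otimes> c_til + c_til \<otimes> a_til - b_til \<otimes> d_til + d_til \<otimes> b_til)
      (a_til \<otimes> d_til + d_til \<otimes> a_til - b_til \<otimes> c_til + c_til \<otimes> b_til)",
      unfolded S14o_gen.case, OF this, folded S14o_comult_def]
  show "algebra_hom S14o_comult" by (rule lift)
  show "S14o_comult a_til = a_til \<otimes> a_til + b_til \<otimes> b_til - c_til \<otimes> c_til + d_til \<otimes> d_til"
    "S14o_comult b_til = a_til \<otimes> b_til + b_til \<otimes> a_til - c_til \<otimes> d_til + d_til \<otimes> c_til"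
    "S14o_comult c_til = a_til \<otimes> c_til + c_til \<otimes> a_til - b_til \<otimes> d_til + d_til \<otimes> b_til"
    "S14o_comult d_til = a_til \<otimes> d_til + d_til \<otimes> a_til - b_til \<otimes> c_til + c_til \<otimes> b_til"
    using lift(2)[of Gen_a] lift(2)[of Gen_b] lift(2)[of Gen_c] lift(2)[of Gen_d]
    by (simp_all flip: a_til_def b_til_def c_til_def d_til_def)
qed

lemma S14o_comult_hat: "matrix_comult S14o_comult a_hat b_hat c_hat d_hat"
  unfolding matrix_comult_def a_hat_def b_hat_def c_hat_def d_hat_def til_matrix_comult
  by (simp add: algebra_homD[OF S14o_comult_hom] S14o_comult_til)

lemma S14o_counit_hom: "algebra_hom S14o_counit"
  and S14o_counit_til: "S14o_counit a_til = 1" "S14o_counit b_til = 0" "S14o_counit c_til = 0"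
    "S14o_counit d_til = 0"
proof -
  have "S14o_relators 1 0 0 (0::complex) \<subseteq> {0}" by (simp add: S14o_relators_def)
  note lift = S14o_lift_hom[of "case_S14o_gen 1 0 0 0", unfolded S14o_gen.case, OF this,
      folded S14o_counit_def]
  show "algebra_hom S14o_counit" by (rule lift)
  show "S14o_counit a_til = 1" "S14o_counit b_til = 0" "S14o_counit c_til = 0" "S14o_counit d_til = 0"
    by (simp_all add: a_til_def b_til_def c_til_def d_til_def lift(2))
qed

lemma S14o_counit_hat:
  "S14o_counit a_hat = 1" "S14o_counit b_hat = 0" "S14o_counit c_hat = 0" "S14o_counit d_hat = 1"
  by (simp_all add: a_hat_def b_hat_def c_hat_def d_hat_def algebra_homD[OF S14o_counit_hom] S14o_counit_til)

lemma bialgebra_S14o: "bialgebra S14o_comult S14o_counit"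
  unfolding bialgebra_iff_coalgebra_at
proof (intro conjI allI)
  note hom = S14o_comult_hom S14o_counit_hom
  show "algebra_hom S14o_comult" "algebra_hom S14o_counit" by (rule hom)+
  fix x show "coalgebra_at S14o_comult S14o_counit x"
    by (induct x rule: S14o_induct_hat)
      (rule coalgebra_at_matrix[OF hom S14o_comult_hat S14o_counit_hat] coalgebra_at_closed[OF hom]; assumption)+
qed

section \<open>The isomorphism with the matrix bialgebra\<close>

lemma GLm_S14o_bialgebra_iso:
  "\<exists>\<phi> :: GLm \<Rightarrow> S14o. bij \<phi> \<and> bialgebra_hom GLm_comult GLm_counit S14o_comult S14o_counit \<phi> \<and>
     \<phi> (gen Mat_a) = a_hat \<and> \<phi> (gen Mat_b) = b_hat \<and> \<phi> (gen Mat_c) = c_hat \<and> \<phi> (gen Mat_d) = d_hat"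
proof -
  define \<phi> :: "GLm \<Rightarrow> S14o" where "\<phi> = presented_lift (case_GLm_gen a_hat b_hat c_hat d_hat)"
  note lift = GLm_lift_hom[of "case_GLm_gen a_hat b_hat c_hat d_hat", unfolded GLm_gen.case,
      OF hat_relations, folded \<phi>_def]
  note \<phi> = algebra_homD[OF lift(1)]
  let ?a = "gen Mat_a" and ?b = "gen Mat_b" and ?c = "gen Mat_c" and ?d = "gen Mat_d"
  \<comment> \<open>The values of the inverse map on the tilded generators, from solving the
    definitions of the hatted ones.\<close>
  let ?w = "(1/2) *\<^sub>C (?a + ?d)" and ?x = "(1/2) *\<^sub>C (?a - ?d)"
    and ?y = "(1/2) *\<^sub>C (?c - ?b)" and ?z = "(1/2) *\<^sub>C (?c + ?b)"
  define \<psi> :: "S14o \<Rightarrow> GLm" where "\<psi> = presented_lift (case_S14o_gen ?w ?x ?y ?z)"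
  have halves: "?w + ?x = ?a" "?w - ?x = ?d" "?z - ?y = ?b" "?y + ?z = ?c"
    using half_sum[of ?a ?d] half_sum[of ?c ?b]
    by (simp_all only: complex_vector.scale_right_diff_distrib scaleC_add_right add_ac)
  have "S14o_relators ?w ?x ?y ?z \<subseteq> {0}"
    unfolding S14o_relations_iff_GLm halves by (rule GLm_relations)
  note lift' = S14o_lift_hom[of "case_S14o_gen ?w ?x ?y ?z", unfolded S14o_gen.case, OF this, folded \<psi>_def]
  note \<psi> = algebra_homD[OF lift'(1)]
  have \<psi>_hat: "\<psi> a_hat = ?a" "\<psi> b_hat = ?b" "\<psi> c_hat = ?c" "\<psi> d_hat = ?d"
    by (simp_all only: a_hat_def b_hat_def c_hat_def d_hat_def a_til_def b_til_def c_til_def d_til_def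
        \<psi> lift'(2) S14o_gen.case halves)
  have "\<phi> (\<psi> x) = x" for x
    by (rule S14o_hom_eqI[OF algebra_hom_comp[OF lift(1) lift'(1)] algebra_hom_id, unfolded id_apply])
      (simp_all add: \<psi>_hat lift(2))
  moreover have "\<psi> (\<phi> x) = x" for x
  proof (induct x rule: presented_induct)
    case (gen g) then show ?case by (cases g) (simp_all add: lift(2) \<psi>_hat)
  qed (simp_all add: \<phi> \<psi>)
  ultimately have "bij \<phi>" by (intro o_bij[of \<psi>]) auto
  moreover have "bialgebra_hom GLm_comult GLm_counit S14o_comult S14o_counit \<phi>"
    unfolding bialgebra_hom_def
  proof (intro conjI allI)
    show "algebra_hom \<phi>" by (rule lift)
    note map = algebra_homD[OF algebra_hom_tensor_map[OF lift(1) lift(1)]]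
      tensor_map_tensor[OF lift(1) lift(1)]
    fix x
    show "S14o_comult (\<phi> x) = tensor_map \<phi> \<phi> (GLm_comult x)"
    proof (induct x rule: presented_induct)
      case (gen g)
      show ?case
        using GLm_comult_gen S14o_comult_hat unfolding matrix_comult_def
        by (cases g) (simp_all add: lift(2) map)
    qed (simp_all add: \<phi> map algebra_homD[OF GLm_comult_hom] algebra_homD[OF S14o_comult_hom])
    show "S14o_counit (\<phi> x) = GLm_counit x"
    proof (induct x rule: presented_induct)
      case (gen g) show ?case by (cases g) (simp_all add: lift(2) GLm_counit_gen S14o_counit_hat)
    qed (simp_all add: \<phi> algebra_homD[OF GLm_counit_hom] algebra_homD[OF S14o_counit_hom])
  qed
  ultimately show ?thesis by (intro exI[of _ \<phi>]) (simp add: lift(2))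
qed


section \<open>The extension by the inverse determinant\<close>

text \<open>The image of \<open>free_omega\<close> enters as a separate \<open>w\<close> so that
  each use can supply it already evaluated: as a group-like tensor, as 1, or as
  \<open>Opp omega_inv\<close>.\<close>

lemma S14o_ext_lift_hom:
  assumes "S14o_relators (v (Old Gen_a)) (v (Old Gen_b)) (v (Old Gen_c)) (v (Old Gen_d)) \<subseteq> {0}"
    and "w = (v (Old Gen_a) + v (Old Gen_b)) * (v (Old Gen_a) - v (Old Gen_b))
      + (v (Old Gen_d) - v (Old Gen_c)) * (v (Old Gen_c) + v (Old Gen_d))"
    and "w * v Omega_inv = 1" "v Omega_inv * w = 1"
  shows "algebra_hom (presented_lift v)" and "presented_lift v (gen g) = v g"
proof -
  note hom = algebra_homD[OF algebra_hom_free_lift]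
  have w: "free_lift v free_omega = w"
    by (simp add: free_omega_def Let_def hom free_lift_gen assms(2))
  have "free_lift v ` relators =
      S14o_relators (v (Old Gen_a)) (v (Old Gen_b)) (v (Old Gen_c)) (v (Old Gen_d)) \<union> {0}"
    by (simp add: relators_S14o_ext_gen_def image_Un algebra_hom_relators[OF algebra_hom_free_lift]
        free_lift_gen hom w assms(3,4))
  then have "free_lift v r = 0" if "r \<in> relators" for r using assms(1) that by blast
  then show "algebra_hom (presented_lift v)" "presented_lift v (gen g) = v g"
    using presented_lift_hom by blast+
qed

lemma ext_incl_hom: "algebra_hom ext_incl" and ext_incl_gen: "ext_incl (gen h) = gen (Old h)"
proof -
  have "S14o_relators (gen (Old Gen_a)) (gen (Old Gen_b)) (gen (Old Gen_c)) (gen (Old Gen_d)) \<subseteq> {0}"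
    unfolding gen_def algebra_hom_relators(1)[OF algebra_hom_abs_presented, symmetric]
    by (auto simp: abs_presented_eq_0_iff relators_S14o_ext_gen_def intro: two_sided_ideal.base)
  note lift = S14o_lift_hom[of "\<lambda>g. gen (Old g)", OF this, folded ext_incl_def]
  show "algebra_hom ext_incl" "ext_incl (gen h) = gen (Old h)" by (rule lift)+
qed

lemma S14o_hom_relations:
  assumes "algebra_hom f"
  shows "S14o_relators (f a_til) (f b_til) (f c_til) (f d_til) \<subseteq> {0}"
    and "GLm_relators (f a_hat) (f b_hat) (f c_hat) (f d_hat) \<subseteq> {0}"
proof -
  have "f ` R \<subseteq> {0}" if "R \<subseteq> {0}" for R using that algebra_homD(5)[OF assms] by auto
  then show "S14o_relators (f a_til) (f b_til) (f c_til) (f d_til) \<subseteq> {0}"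
    "GLm_relators (f a_hat) (f b_hat) (f c_hat) (f d_hat) \<subseteq> {0}"
    unfolding algebra_hom_relators[OF assms, symmetric]
    using S14o_relations hat_relations by blast+
qed

lemma S14o_hom_omega:
  assumes "algebra_hom f" shows "f omega = f a_hat * f d_hat + f b_hat * f c_hat"
  by (simp add: omega_def algebra_homD[OF assms])

lemma ext_omega_inverse: "ext_incl omega * omega_inv = 1" "omega_inv * ext_incl omega = 1"
proof -
  note hom = algebra_homD[OF algebra_hom_abs_presented]
  have om: "ext_incl omega = abs_presented free_omega"
    by (simp add: S14o_hom_omega[OF ext_incl_hom] a_hat_def b_hat_def c_hat_def d_hat_def
        algebra_homD[OF ext_incl_hom] a_til_def b_til_def c_til_def d_til_def ext_incl_gen
        free_omega_def Let_def hom flip: gen_def)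
  have "abs_presented (free_omega * free_gen Omega_inv - 1) = 0"
    "abs_presented (free_gen Omega_inv * free_omega - 1) = 0"
    unfolding abs_presented_eq_0_iff
    by (rule two_sided_ideal.base, simp add: relators_S14o_ext_gen_def)+
  then show "ext_incl omega * omega_inv = 1" "omega_inv * ext_incl omega = 1"
    by (simp_all add: om omega_inv_def gen_def hom)
qed

text \<open>Multiply the centrality identity for \<omega> by its inverse on both sides.\<close>

lemma omega_inv_commute:
  assumes "x \<in> {ext_incl a_hat, ext_incl b_hat, ext_incl c_hat, ext_incl d_hat}"
  shows "x * omega_inv = omega_inv * x"
proof -
  have "ext_incl omega * x = x * ext_incl omega"
    unfolding S14o_hom_omega[OF ext_incl_hom]
    by (rule GLm_det_central[OF S14o_hom_relations(2)[OF ext_incl_hom] assms])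
  then have "omega_inv * (ext_incl omega * x) * omega_inv = omega_inv * (x * ext_incl omega) * omega_inv"
    by simp
  moreover have "omega_inv * (ext_incl omega * x) * omega_inv = x * omega_inv"
    by (simp add: ext_omega_inverse flip: mult.assoc)
  moreover have "omega_inv * (x * ext_incl omega) * omega_inv = omega_inv * x"
    by (simp add: ext_omega_inverse mult.assoc)
  ultimately show ?thesis by simp
qed

lemma S14o_ext_induct [case_names a_hat b_hat c_hat d_hat omega_inv one add scaleC mult]:
  assumes hat: "P (ext_incl a_hat)" "P (ext_incl b_hat)" "P (ext_incl c_hat)" "P (ext_incl d_hat)"
    and omega_inv: "P omega_inv" and one: "P 1"
    and add: "\<And>x y. P x \<Longrightarrow> P y \<Longrightarrow> P (x + y)"
    and scaleC: "\<And>c x. P x \<Longrightarrow> P (c *\<^sub>C x)" and mult: "\<And>x y. P x \<Longrightarrow> P y \<Longrightarrow> P (x * y)"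
  shows "P x"
proof (induct x rule: presented_induct)
  case (gen g)
  have "P (ext_incl x)" for x
    by (induct x rule: S14o_induct_hat)
      (simp_all add: hat algebra_homD[OF ext_incl_hom] one add scaleC mult)
  then show ?case
    by (cases g) (simp_all add: omega_inv flip: ext_incl_gen omega_inv_def)
qed (rule one add scaleC mult; assumption)+

lemma ext_comult_hom: "algebra_hom ext_comult"
  and ext_comult_incl: "ext_comult (ext_incl x) = tensor_map ext_incl ext_incl (S14o_comult x)"
  and ext_comult_omega_inv: "ext_comult omega_inv = omega_inv \<otimes> omega_inv"
  and ext_comult_omega: "ext_comult (ext_incl omega) = ext_incl omega \<otimes> ext_incl omega"
proof -
  note map = algebra_hom_tensor_map[OF ext_incl_hom ext_incl_hom]
  \<comment> \<open>As a homomorphism on S14o, \<open>f\<close> carries the relations of S14o to the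
    required values; only the invertibility of \<open>f omega\<close> remains.\<close>
  define f where "f x = tensor_map ext_incl ext_incl (S14o_comult x)" for x
  have f: "algebra_hom f"
    unfolding f_def by (rule algebra_hom_comp[OF map S14o_comult_hom])
  have "S14o_comult omega = omega \<otimes> omega"
    using S14o_comult_hat
    by (simp only: S14o_hom_omega[OF S14o_comult_hom] matrix_comult_def
        GLm_relations_matrix(2)[OF hat_relations]) (simp only: omega_def)
  \<comment> \<open>Hence \<open>omega_inv \<otimes> omega_inv\<close> inverts
    \<open>f omega\<close> and is an admissible value on \<open>Omega_inv\<close>.\<close>
  then have om: "f omega = ext_incl omega \<otimes> ext_incl omega"
    by (simp add: f_def tensor_map_tensor[OF ext_incl_hom ext_incl_hom])
  define v where "v = (\<lambda>g. case g of Old h \<Rightarrow> f (gen h) | Omega_inv \<Rightarrow> omega_inv \<otimes> omega_inv)"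
  have v: "ext_comult = presented_lift v" unfolding ext_comult_def v_def f_def ..
  have 1: "S14o_relators (v (Old Gen_a)) (v (Old Gen_b)) (v (Old Gen_c)) (v (Old Gen_d)) \<subseteq> {0}"
    using S14o_hom_relations(1)[OF f] by (simp add: v_def a_til_def b_til_def c_til_def d_til_def)
  have 2: "f omega = (v (Old Gen_a) + v (Old Gen_b)) * (v (Old Gen_a) - v (Old Gen_b))
      + (v (Old Gen_d) - v (Old Gen_c)) * (v (Old Gen_c) + v (Old Gen_d))"
    by (simp add: v_def S14o_hom_omega[OF f] a_hat_def b_hat_def c_hat_def d_hat_def
        algebra_homD[OF f] a_til_def b_til_def c_til_def d_til_def)
  have 3: "f omega * v Omega_inv = 1" "v Omega_inv * f omega = 1"
    by (simp_all add: om v_def tensor_mult_tensor ext_omega_inverse one_tensor_def)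
  note lift = S14o_ext_lift_hom[OF 1 2 3, folded v]
  show hom: "algebra_hom ext_comult" by (rule lift)
  show "ext_comult omega_inv = omega_inv \<otimes> omega_inv" by (simp add: omega_inv_def lift(2) v_def)
  have incl: "ext_comult (ext_incl x) = f x" for x
  proof (induct x rule: presented_induct)
    case (gen g) show ?case by (simp add: ext_incl_gen lift(2) v_def)
  qed (simp_all add: algebra_homD[OF hom] algebra_homD[OF f] algebra_homD[OF ext_incl_hom])
  then show "ext_comult (ext_incl x) = tensor_map ext_incl ext_incl (S14o_comult x)"
    by (simp add: f_def)
  show "ext_comult (ext_incl omega) = ext_incl omega \<otimes> ext_incl omega" by (simp add: incl om)
qed

lemma ext_comult_hat:
  "matrix_comult ext_comult (ext_incl a_hat) (ext_incl b_hat) (ext_incl c_hat) (ext_incl d_hat)"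
  using S14o_comult_hat
  by (simp add: matrix_comult_def ext_comult_incl tensor_map_tensor[OF ext_incl_hom ext_incl_hom]
      algebra_homD[OF algebra_hom_tensor_map[OF ext_incl_hom ext_incl_hom]])

lemma ext_counit_hom: "algebra_hom ext_counit"
  and ext_counit_incl: "ext_counit (ext_incl x) = S14o_counit x"
  and ext_counit_omega_inv: "ext_counit omega_inv = 1"
  and ext_counit_omega: "ext_counit (ext_incl omega) = 1"
proof -
  note f = S14o_counit_hom
  define v where "v = (\<lambda>g. case g of Old h \<Rightarrow> S14o_counit (gen h) | Omega_inv \<Rightarrow> 1)"
  have v: "ext_counit = presented_lift v" unfolding ext_counit_def v_def ..
  have 1: "S14o_relators (v (Old Gen_a)) (v (Old Gen_b)) (v (Old Gen_c)) (v (Old Gen_d)) \<subseteq> {0}"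
    using S14o_hom_relations(1)[OF f] by (simp add: v_def a_til_def b_til_def c_til_def d_til_def)
  have 2: "S14o_counit omega = (v (Old Gen_a) + v (Old Gen_b)) * (v (Old Gen_a) - v (Old Gen_b))
      + (v (Old Gen_d) - v (Old Gen_c)) * (v (Old Gen_c) + v (Old Gen_d))"
    by (simp add: v_def S14o_hom_omega[OF f] a_hat_def b_hat_def c_hat_def d_hat_def
        algebra_homD[OF f] a_til_def b_til_def c_til_def d_til_def)
  have om: "S14o_counit omega = 1" by (simp add: S14o_hom_omega[OF f] S14o_counit_hat)
  have 3: "S14o_counit omega * v Omega_inv = 1" "v Omega_inv * S14o_counit omega = 1"
    by (simp_all add: om v_def)
  note lift = S14o_ext_lift_hom[OF 1 2 3, folded v]
  show hom: "algebra_hom ext_counit" by (rule lift)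
  show "ext_counit omega_inv = 1" by (simp add: omega_inv_def lift(2) v_def)
  show incl: "ext_counit (ext_incl x) = S14o_counit x" for x
  proof (induct x rule: presented_induct)
    case (gen g) show ?case by (simp add: ext_incl_gen lift(2) v_def)
  qed (simp_all add: algebra_homD[OF hom] algebra_homD[OF f] algebra_homD[OF ext_incl_hom])
  show "ext_counit (ext_incl omega) = 1" by (simp add: incl om)
qed

lemma bialgebra_hom_ext_incl:
  "bialgebra_hom S14o_comult S14o_counit ext_comult ext_counit ext_incl"
  by (simp add: bialgebra_hom_def ext_incl_hom ext_comult_incl ext_counit_incl)

lemma bialgebra_ext: "bialgebra ext_comult ext_counit"
  unfolding bialgebra_iff_coalgebra_at
proof (intro conjI allI)
  note hom = ext_comult_hom ext_counit_hom
  show "algebra_hom ext_comult" "algebra_hom ext_counit" by (rule hom)+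
  have hat: "coalgebra_at ext_comult ext_counit (ext_incl a_hat)"
    "coalgebra_at ext_comult ext_counit (ext_incl b_hat)"
    "coalgebra_at ext_comult ext_counit (ext_incl c_hat)"
    "coalgebra_at ext_comult ext_counit (ext_incl d_hat)"
    using coalgebra_at_matrix[OF hom ext_comult_hat] by (simp_all add: ext_counit_incl S14o_counit_hat)
  have omega_inv: "coalgebra_at ext_comult ext_counit omega_inv"
    by (simp add: coalgebra_at_def ext_comult_omega_inv tensor_map_tensor[OF hom(1) algebra_hom_id]
        tensor_map_tensor[OF algebra_hom_id hom(1)] tensor_assoc_tensor ext_counit_omega_inv scaleC_one
        tensor_lift_tensor[OF algebra_hom_counit_left(1)[OF hom(2)]]
        tensor_lift_tensor[OF algebra_hom_counit_right(1)[OF hom(2)]])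
  fix x show "coalgebra_at ext_comult ext_counit x"
    by (induct x rule: S14o_ext_induct) (rule hat omega_inv coalgebra_at_closed[OF hom]; assumption)+
qed

text \<open>The prescribed matrix is \<omega>\<inverse> T' with T' = (d b; c a). The relations give
  T T' = T' T = \<omega> times the identity, so on matrix entries the antipode identities say that
  \<omega>\<inverse> T' is the inverse of T.\<close>

lemma ext_antipode:
  "\<exists>\<gamma>. antipode ext_comult ext_counit \<gamma> \<and>
     \<gamma> (ext_incl a_hat) = omega_inv * ext_incl d_hat \<and>
     \<gamma> (ext_incl b_hat) = omega_inv * ext_incl b_hat \<and>
     \<gamma> (ext_incl c_hat) = omega_inv * ext_incl c_hat \<and>
     \<gamma> (ext_incl d_hat) = omega_inv * ext_incl a_hat \<and>
     \<gamma> (ext_incl omega) = omega_inv \<and> \<gamma> omega_inv = ext_incl omega"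
proof -
  let ?a = "ext_incl a_hat" and ?b = "ext_incl b_hat" and ?c = "ext_incl c_hat" and ?d = "ext_incl d_hat"
  let ?w = "omega_inv * ext_incl a_til" and ?x = "- (omega_inv * ext_incl b_til)"
    and ?y = "omega_inv * ext_incl c_til" and ?z = "omega_inv * ext_incl d_til"
  note incl = algebra_homD[OF ext_incl_hom]
  \<comment> \<open>From the required values \<open>\<omega>\<inverse> d, \<omega>\<inverse> b, \<omega>\<inverse> c, \<omega>\<inverse> a\<close> on the hatted generators,
    by taking half sums and differences.\<close>
  define v where "v = case_S14o_ext_gen (case_S14o_gen (Opp ?w) (Opp ?x) (Opp ?y) (Opp ?z)) (Opp (ext_incl omega))"
  have sums: "Opp ?w + Opp ?x = Opp (omega_inv * ?d)" "Opp ?z - Opp ?y = Opp (omega_inv * ?b)"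
    "Opp ?y + Opp ?z = Opp (omega_inv * ?c)" "Opp ?w - Opp ?x = Opp (omega_inv * ?a)"
    by (simp_all add: opp_eq_iff unopp_simps a_hat_def b_hat_def c_hat_def d_hat_def incl algebra_simps)
  have rel: "GLm_relators ?a ?b ?c ?d \<subseteq> {0}" by (rule S14o_hom_relations(2)[OF ext_incl_hom])
  note ord = GLm_relations_ordered[OF rel]
  \<comment> \<open>Collects all factors \<open>omega_inv\<close> on the left, leaving products of
    entries that \<open>ord\<close> can sort.\<close>
  have comm: "x * (omega_inv * y) = omega_inv * (x * y)" if "x \<in> {?a, ?b, ?c, ?d}" for x y
    using omega_inv_commute[OF that] by (metis mult.assoc)
  have om: "?a * ?d + ?b * ?c = ext_incl omega" by (simp add: S14o_hom_omega[OF ext_incl_hom])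
  have 1: "S14o_relators (v (Old Gen_a)) (v (Old Gen_b)) (v (Old Gen_c)) (v (Old Gen_d)) \<subseteq> {0}"
    unfolding v_def S14o_ext_gen.case S14o_gen.case S14o_relations_iff_GLm sums GLm_relations_opp
    by (rule GLm_relations_adjugate[OF rel omega_inv_commute])
  \<comment> \<open>The determinant of \<omega>\<inverse> T': two inverse factors against one
    \<omega>. So \<omega> must go to \<omega>\<inverse>, which the value
    \<open>Opp (ext_incl omega)\<close> on \<open>Omega_inv\<close> inverts.\<close>
  have "omega_inv * (omega_inv * (?a * ?d + ?b * ?c)) = omega_inv"
    by (simp add: om ext_omega_inverse)
  then have 2: "Opp omega_inv = (v (Old Gen_a) + v (Old Gen_b)) * (v (Old Gen_a) - v (Old Gen_b))
      + (v (Old Gen_d) - v (Old Gen_c)) * (v (Old Gen_c) + v (Old Gen_d))"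
    unfolding v_def S14o_ext_gen.case S14o_gen.case sums
    by (simp add: opp_eq_iff unopp_simps mult.assoc comm ord distrib_left)
  have 3: "Opp omega_inv * v Omega_inv = 1" "v Omega_inv * Opp omega_inv = 1"
    by (simp_all add: v_def opp_eq_iff unopp_simps ext_omega_inverse)
  note lift = S14o_ext_lift_hom[OF 1 2 3]
  define \<gamma> where "\<gamma> x = unopp (presented_lift v x)" for x
  have \<gamma>: "\<gamma> (x + y) = \<gamma> x + \<gamma> y" "\<gamma> (x - y) = \<gamma> x - \<gamma> y" "\<gamma> (c *\<^sub>C x) = c *\<^sub>C \<gamma> x"
    "\<gamma> 1 = 1" "\<gamma> (x * y) = \<gamma> y * \<gamma> x" for x y c
    by (simp_all add: \<gamma>_def algebra_homD[OF lift(1)] unopp_simps)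
  have til: "\<gamma> (ext_incl a_til) = ?w" "\<gamma> (ext_incl b_til) = ?x" "\<gamma> (ext_incl c_til) = ?y"
    "\<gamma> (ext_incl d_til) = ?z"
    by (simp_all add: \<gamma>_def a_til_def b_til_def c_til_def d_til_def ext_incl_gen lift(2))
      (simp_all add: v_def a_til_def b_til_def c_til_def d_til_def ext_incl_gen)
  have inv: "\<gamma> omega_inv = ext_incl omega"
    by (simp add: \<gamma>_def omega_inv_def lift(2)) (simp add: v_def)
  have hat: "\<gamma> ?a = omega_inv * ?d" "\<gamma> ?b = omega_inv * ?b" "\<gamma> ?c = omega_inv * ?c" "\<gamma> ?d = omega_inv * ?a"
    by (simp_all add: a_hat_def b_hat_def c_hat_def d_hat_def incl \<gamma> til algebra_simps)
  have "\<gamma> (ext_incl omega) = omega_inv * (omega_inv * (?a * ?d + ?b * ?c))"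
    by (simp add: S14o_hom_omega[OF ext_incl_hom] \<gamma> hat mult.assoc comm ord distrib_left)
  then have om_inv: "\<gamma> (ext_incl omega) = omega_inv" by (simp add: om ext_omega_inverse)
  have lin: "clinear \<gamma>" by (rule clinearI) (rule \<gamma>)+
  note bil = cbilinear_antipode[OF lin]
  note lifts = bil[THEN tensor_lift_add] bil[THEN tensor_lift_tensor]
  have det: "omega_inv * (?a * ?d) + omega_inv * (?b * ?c) = 1"
    by (simp add: om ext_omega_inverse flip: distrib_left)
  have com: "ext_comult ?a = ?a \<otimes> ?a + ?b \<otimes> ?c" "ext_comult ?b = ?a \<otimes> ?b + ?b \<otimes> ?d"
    "ext_comult ?c = ?c \<otimes> ?a + ?d \<otimes> ?c" "ext_comult ?d = ?c \<otimes> ?b + ?d \<otimes> ?d"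
    using ext_comult_hat by (simp_all add: matrix_comult_def)
  have at_hat: "antipode_at ext_comult ext_counit \<gamma> ?a" "antipode_at ext_comult ext_counit \<gamma> ?b"
    "antipode_at ext_comult ext_counit \<gamma> ?c" "antipode_at ext_comult ext_counit \<gamma> ?d"
    using det
    by (simp_all add: antipode_at_def lifts com ext_counit_incl S14o_counit_hat hat mult.assoc comm ord
        scaleC_one add.commute)
  have at_omega_inv: "antipode_at ext_comult ext_counit \<gamma> omega_inv"
    by (simp add: antipode_at_def lifts ext_comult_omega_inv inv ext_counit_omega_inv
        ext_omega_inverse scaleC_one)
  have "antipode_at ext_comult ext_counit \<gamma> x" for x
    by (induct x rule: S14o_ext_induct)
      (rule at_hat at_omega_inv antipode_at_closed[OF ext_comult_hom ext_counit_hom lin \<gamma>(4,5)]; assumption)+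
  then have "antipode ext_comult ext_counit \<gamma>"
    using lin by (simp add: antipode_def antipode_at_def)
  with hat inv om_inv show ?thesis by blast
qed

theorem mainTheorem14:
  fixes w x y z :: "'a::complex_algebra"
  shows
    "(bialgebra S14o_comult S14o_counit \<and>
      S14o_comult a_til = a_til \<otimes> a_til + b_til \<otimes> b_til - c_til \<otimes> c_til + d_til \<otimes> d_til \<and>
      S14o_comult b_til = a_til \<otimes> b_til + b_til \<otimes> a_til - c_til \<otimes> d_til + d_til \<otimes> c_til \<and>
      S14o_comult c_til = a_til \<otimes> c_til + c_til \<otimes> a_til - b_til \<otimes> d_til + d_til \<otimes> b_til \<and>
      S14o_comult d_til = a_til \<otimes> d_til + d_til \<otimes> a_til - b_til \<otimes> c_til + c_til \<otimes> b_til \<and>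
      S14o_counit a_til = 1 \<and> S14o_counit b_til = 0 \<and> S14o_counit c_til = 0 \<and> S14o_counit d_til = 0)
     \<and>
     ((x * w = w * x \<and> y * w = - (w * y) \<and> z * w = - (w * z) \<and>
       y * x = - (x * y) \<and> z * x = - (x * z) \<and> z * y = y * z)
      \<longleftrightarrow>
      (let a = w + x; b = z - y; c = y + z; d = w - x in
       b * a = - (a * b) \<and> c * a = - (a * c) \<and> d * a = a * d \<and>
       c * b = b * c \<and> b * d = - (d * b) \<and> c * d = - (d * c)))
     \<and>
     (let a = free_gen Gen_a; b = free_gen Gen_b; c = free_gen Gen_c; d = free_gen Gen_d in
      two_sided_ideal (S14o_relators a b c d)
        = two_sided_ideal (GLm_relators (a + b) (d - c) (c + d) (a - b)))
     \<and>
     (S14o_comult a_hat = a_hat \<otimes> a_hat + b_hat \<otimes> c_hat \<and>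
      S14o_comult b_hat = a_hat \<otimes> b_hat + b_hat \<otimes> d_hat \<and>
      S14o_comult c_hat = c_hat \<otimes> a_hat + d_hat \<otimes> c_hat \<and>
      S14o_comult d_hat = c_hat \<otimes> b_hat + d_hat \<otimes> d_hat \<and>
      S14o_counit a_hat = 1 \<and> S14o_counit b_hat = 0 \<and> S14o_counit c_hat = 0 \<and> S14o_counit d_hat = 1)
     \<and>
     (bialgebra GLm_comult GLm_counit \<and>
      (\<exists>\<phi> :: GLm \<Rightarrow> S14o. bij \<phi> \<and> bialgebra_hom GLm_comult GLm_counit S14o_comult S14o_counit \<phi> \<and>
         \<phi> (gen Mat_a) = a_hat \<and> \<phi> (gen Mat_b) = b_hat \<and>
         \<phi> (gen Mat_c) = c_hat \<and> \<phi> (gen Mat_d) = d_hat))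
     \<and>
     (bialgebra ext_comult ext_counit \<and>
      bialgebra_hom S14o_comult S14o_counit ext_comult ext_counit ext_incl \<and>
      ext_incl omega * omega_inv = 1 \<and> omega_inv * ext_incl omega = 1 \<and>
      ext_comult (ext_incl omega) = ext_incl omega \<otimes> ext_incl omega \<and>
      ext_comult omega_inv = omega_inv \<otimes> omega_inv \<and>
      ext_counit (ext_incl omega) = 1 \<and> ext_counit omega_inv = 1 \<and>
      (\<exists>\<gamma>. antipode ext_comult ext_counit \<gamma> \<and>
         \<gamma> (ext_incl a_hat) = omega_inv * ext_incl d_hat \<and>
         \<gamma> (ext_incl b_hat) = omega_inv * ext_incl b_hat \<and>
         \<gamma> (ext_incl c_hat) = omega_inv * ext_incl c_hat \<and>
         \<gamma> (ext_incl d_hat) = omega_inv * ext_incl a_hat \<and>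
         \<gamma> (ext_incl omega) = omega_inv \<and> \<gamma> omega_inv = ext_incl omega))"
proof -
  have "S14o_relators w x y z \<subseteq> {0} \<longleftrightarrow> GLm_relators (w + x) (z - y) (y + z) (w - x) \<subseteq> {0}"
    by (rule S14o_relations_iff_GLm)
  note relations = this[unfolded S14o_relations_iff GLm_relations_iff]
  show ?thesis
    unfolding Let_def
    by (intro conjI relations ideal_S14o_eq_GLm bialgebra_S14o S14o_comult_til S14o_counit_til
        S14o_comult_hat[unfolded matrix_comult_def, THEN conjunct1]
        S14o_comult_hat[unfolded matrix_comult_def, THEN conjunct2, THEN conjunct1]
        S14o_comult_hat[unfolded matrix_comult_def, THEN conjunct2, THEN conjunct2, THEN conjunct1]
        S14o_comult_hat[unfolded matrix_comult_def, THEN conjunct2, THEN conjunct2, THEN conjunct2]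
        S14o_counit_hat bialgebra_GLm GLm_S14o_bialgebra_iso bialgebra_ext bialgebra_hom_ext_incl
        ext_omega_inverse ext_comult_omega ext_comult_omega_inv ext_counit_omega
        ext_counit_omega_inv ext_antipode)
qed

end
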